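(* Let $f\colon X\to Y$ be a based map between based spaces satisfying the standing assumptions in the context, let $L_fY$ be the pullback of the free loop fibration $\Lambda Y\to Y$ along $f$, and let $\phi\colon\Lambda X\to L_fY$ be the canonical whisker map. For each $n\geq 2$ there is an isomorphism of abelian groups $$G_n\big(L_fY,\Lambda X;\phi\big)\cong G_n(X)\oplus G_{n+1}(Y,X;f).$$
   Context: Standing assumptions: $X$ and $Y$ are based spaces that are connected, locally compact, Hausdorff and well-pointed (no finiteness or simple connectivity is assumed). Mapping spaces consist of unbased maps and carry the compact-open topology. $\Lambda Y=\mathrm{map}(S^1,Y;0)$ is the path component of the null (constant) maps in the free loop space of $Y$, with the constant loop at the basepoint as basepoint, and $\mathrm{ev}\colon\Lambda Y\to Y$ is evaluation at the basepoint $s_0$ of $S^1$. The relative free loop space is the pullback of $\mathrm{ev}$ along $f$: $L_fY=\{(x,\gamma)\in X\times\Lambda Y : f(x)=\gamma(s_0)\}$. The whisker map $\phi=(\mathrm{ev},f_* )\colon\Lambda X\to L_fY$ is $\phi(\alpha)=(\alpha(s_0),f\circ\alpha)$. For a based map $g\colon U\to V$, $\mathrm{map}(U,V;g)$ is the path component of $g$ in the space of unbased maps $U\to V$, based at $g$, and $\omega\colon\mathrm{map}(U,V;g)\to V$ is evaluation at the basepoint of $U$. The $n$th evaluation subgroup (relative Gottlieb group) $G_n(V,U;g)$ is the image of $\omega_\#\colon\pi_n(\mathrm{map}(U,V;g))\to\pi_n(V)$. The $n$th Gottlieb group is $G_n(V)=G_n(V,V;1_V)$.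
   Formalization: "Connected" is taken to mean path-connected for X and Y; for spaces X that are connected but not path-connected the stated isomorphism can fail, already when Y is a point. *)

theory Defs
  imports "HOL-Analysis.Analysis" "HOL-Algebra.Group"
begin

text \<open>
  The inclusion of the base point is a cofibration, that is, it has the homotopy extension
  property with respect to every space \<open>Z\<close>.  A definition cannot quantify over the type of points
  of \<open>Z\<close>.  Test spaces on the type \<open>real \<times> 'a\<close> are enough, because this type contains the mapping
  cylinder of the inclusion: lemma \<open>well_pointed_homotopy_extension\<close> derives the property for a
  target on an arbitrary type (for a closed point, as in any Hausdorff space).
\<close>

definition well_pointed :: "'a topology \<Rightarrow> 'a \<Rightarrow> bool" where
  "well_pointed X x0 \<longleftrightarrow> x0 \<in> topspace X \<and>
     (\<forall>(Z :: (real \<times> 'a) topology) f \<gamma>.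
        continuous_map X Z f \<and> pathin Z \<gamma> \<and> \<gamma> 0 = f x0 \<longrightarrow>
        (\<exists>H. continuous_map (prod_topology (top_of_set {0..1}) X) Z H \<and>
             (\<forall>x\<in>topspace X. H (0, x) = f x) \<and> (\<forall>t\<in>{0..1}. H (t, x0) = \<gamma> t)))"

lemma well_pointed_homotopy_extension:
  fixes X :: "'a topology" and Z :: "'c topology"
  assumes wp: "well_pointed X x0" and cl: "closedin X {x0}"
    and g: "continuous_map X Z g" and \<delta>: "pathin Z \<delta>" and start: "\<delta> 0 = g x0"
  shows "\<exists>H. continuous_map (prod_topology (top_of_set {0..1}) X) Z H \<and>
             (\<forall>x\<in>topspace X. H (0, x) = g x) \<and> (\<forall>t\<in>{0..1}. H (t, x0) = \<delta> t)"
proof -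
  let ?I = "top_of_set {0..1::real}"
  let ?P = "prod_topology ?I X"
  define S where "S = ({0} \<times> topspace X) \<union> ({0..1::real} \<times> {x0})"
  define W where "W = subtopology ?P S"
  have x0: "x0 \<in> topspace X"
    using wp by (simp add: well_pointed_def)
  have S: "S \<subseteq> topspace ?P"
    using x0 by (auto simp: S_def)
  have f: "continuous_map X W (\<lambda>x. (0, x))"
    unfolding W_def by (auto simp: continuous_map_in_subtopology continuous_map_pairwise o_def S_def)
  have "continuous_map ?I W (\<lambda>t. (t, x0))"
    unfolding W_def using x0
    by (auto simp: continuous_map_in_subtopology continuous_map_pairwise o_def S_def
             simp del: continuous_map_subtopology_eu continuous_map_iff_continuous)
  then have "pathin W (\<lambda>t. (t, x0))"
    by (simp add: pathin_def)
  moreover have "continuous_map X W f \<and> pathin W \<gamma> \<and> \<gamma> 0 = f x0 \<longrightarrow>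
      (\<exists>H. continuous_map ?P W H \<and> (\<forall>x\<in>topspace X. H (0, x) = f x) \<and>
           (\<forall>t\<in>{0..1}. H (t, x0) = \<gamma> t))" for f \<gamma>
    using wp unfolding well_pointed_def by blast
  from this[of "\<lambda>x. (0, x)" "\<lambda>t. (t, x0)"] f calculation
  obtain H where H: "continuous_map ?P W H"
    and H0: "\<And>x. x \<in> topspace X \<Longrightarrow> H (0, x) = (0, x)"
    and H1: "\<And>t. t \<in> {0..1} \<Longrightarrow> H (t, x0) = (t, x0)"
    by auto
  have pr: "continuous_map W ?I fst" "continuous_map W X snd"
    unfolding W_def
    by (intro continuous_map_from_subtopology continuous_map_fst continuous_map_snd)+
  have topW: "topspace W = S"
    using S by (auto simp: W_def)
  have 1: "closedin W {w \<in> topspace W. fst w \<in> {0}}"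
    by (rule closedin_continuous_map_preimage[OF pr(1)]) (auto simp: closedin_closed_eq)
  have 2: "closedin W {w \<in> topspace W. snd w \<in> {x0}}"
    by (rule closedin_continuous_map_preimage[OF pr(2) cl])
  define K where "K = (\<lambda>w::real \<times> 'a. if fst w \<in> {0} then g (snd w) else \<delta> (fst w))"
  have "continuous_map W Z K"
    unfolding K_def
  proof (rule continuous_map_cases)
    show "continuous_map (subtopology W (W closure_of {w. fst w \<in> {0}})) Z (\<lambda>w. g (snd w))"
      using continuous_map_compose[OF pr(2) g]
      by (intro continuous_map_from_subtopology) (simp add: o_def)
    show "continuous_map (subtopology W (W closure_of {w. fst w \<notin> {0}})) Z (\<lambda>w. \<delta> (fst w))"
      using continuous_map_compose[OF pr(1)] \<delta>
      by (intro continuous_map_from_subtopology) (simp add: o_def pathin_def)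
    fix w
    assume w: "w \<in> W frontier_of {w. fst w \<in> {0}}"
    have "w \<in> W closure_of {w. fst w \<in> {0}}"
      using w by (simp add: frontier_of_closures)
    moreover have "w \<in> W closure_of {w. fst w \<notin> {0}}"
    proof -
      have "w \<in> W closure_of (topspace W - {w. fst w \<in> {0}})"
        using w by (simp add: frontier_of_closures)
      moreover have "topspace W - {w. fst w \<in> {0}} \<subseteq> {w. fst w \<notin> {0}}" by blast
      ultimately show ?thesis
        using closure_of_mono by blast
    qed
    moreover have "W closure_of {w. fst w \<in> {0}} \<subseteq> {w \<in> topspace W. fst w \<in> {0}}"
    proof -
      have "topspace W \<inter> {w. fst w \<in> {0}} \<subseteq> {w \<in> topspace W. fst w \<in> {0}}"
        by blast
      from closure_of_minimal[OF this 1] show ?thesis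
        by (simp only: closure_of_restrict[symmetric])
    qed
    moreover have "W closure_of {w. fst w \<notin> {0}} \<subseteq> {w \<in> topspace W. snd w \<in> {x0}}"
    proof -
      have "topspace W \<inter> {w. fst w \<notin> {0}} \<subseteq> {w \<in> topspace W. snd w \<in> {x0}}"
        by (auto simp: topW S_def)
      from closure_of_minimal[OF this 2] show ?thesis
        by (simp only: closure_of_restrict[symmetric])
    qed
    ultimately have "fst w = 0" "snd w = x0" by auto
    then show "g (snd w) = \<delta> (fst w)"
      using start by simp
  qed
  then have "continuous_map ?P Z (K \<circ> H)"
    by (rule continuous_map_compose[OF H])
  moreover have "\<forall>x\<in>topspace X. (K \<circ> H) (0, x) = g x"
    by (simp add: H0 K_def)
  moreover have "\<forall>t\<in>{0..1}. (K \<circ> H) (t, x0) = \<delta> t"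
    using H1 start by (simp add: K_def)
  ultimately show ?thesis by blast
qed

text \<open>
  Maps \<open>U \<rightarrow> V\<close> are represented by functions that are \<open>undefined\<close> off \<open>topspace U\<close>, so that equality
  of points of the mapping space is equality of maps.
\<close>

definition compact_open_topology :: "'a topology \<Rightarrow> 'b topology \<Rightarrow> ('a \<Rightarrow> 'b) topology" where
  "compact_open_topology U V =
     topology_generated_by
       {{g. continuous_map U V g \<and> g \<in> extensional (topspace U) \<and> g ` K \<subseteq> W} | K W.
          compactin U K \<and> openin V W}"

lemma topspace_compact_open_topology:
  "topspace (compact_open_topology U V) =
     {g. continuous_map U V g \<and> g \<in> extensional (topspace U)}"
proof -
  have "\<Union>{{g. continuous_map U V g \<and> g \<in> extensional (topspace U) \<and> g ` K \<subseteq> W} | K W.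
            compactin U K \<and> openin V W} =
        {g. continuous_map U V g \<and> g \<in> extensional (topspace U)}" (is "\<Union>?S = ?C")
  proof
    have "?C \<in> ?S"
      by (rule CollectI, rule exI[of _ "{}"], rule exI[of _ "{}"]) simp
    then show "?C \<subseteq> \<Union>?S" by blast
  qed blast
  then show ?thesis
    by (simp add: compact_open_topology_def)
qed

definition map_component :: "'a topology \<Rightarrow> 'b topology \<Rightarrow> ('a \<Rightarrow> 'b) \<Rightarrow> ('a \<Rightarrow> 'b) topology" where
  "map_component U V g =
     subtopology (compact_open_topology U V)
       (path_component_of_set (compact_open_topology U V) (restrict g (topspace U)))"

text \<open>
  \<open>homotopy_group n X x0\<close> is $\pi_n(X,x_0)$ for $n \geq 1$: homotopy classes, relative to the
  boundary, of maps from the $n$-cube that send the boundary to the base point, multiplied by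
  juxtaposition in the first coordinate.
\<close>

definition cube :: "nat \<Rightarrow> (nat \<Rightarrow> real) topology" where
  "cube n = product_topology (\<lambda>_. top_of_set {0..1}) {..<n}"

definition cube_boundary :: "nat \<Rightarrow> (nat \<Rightarrow> real) set" where
  "cube_boundary n = {s \<in> topspace (cube n). \<exists>i<n. s i = 0 \<or> s i = 1}"

definition spheroids :: "nat \<Rightarrow> 'a topology \<Rightarrow> 'a \<Rightarrow> ((nat \<Rightarrow> real) \<Rightarrow> 'a) set" where
  "spheroids n X x0 =
     {p. continuous_map (cube n) X p \<and> p \<in> extensional (topspace (cube n)) \<and>
         (\<forall>s\<in>cube_boundary n. p s = x0)}"

definition spheroid_class ::
    "nat \<Rightarrow> 'a topology \<Rightarrow> 'a \<Rightarrow> ((nat \<Rightarrow> real) \<Rightarrow> 'a) \<Rightarrow> ((nat \<Rightarrow> real) \<Rightarrow> 'a) set" where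
  "spheroid_class n X x0 p =
     {q \<in> spheroids n X x0.
        homotopic_with (\<lambda>h. \<forall>s\<in>cube_boundary n. h s = x0) (cube n) X p q}"

definition spheroid_mult ::
    "nat \<Rightarrow> ((nat \<Rightarrow> real) \<Rightarrow> 'a) \<Rightarrow> ((nat \<Rightarrow> real) \<Rightarrow> 'a) \<Rightarrow> (nat \<Rightarrow> real) \<Rightarrow> 'a" where
  "spheroid_mult n p q =
     (\<lambda>s\<in>topspace (cube n).
        if s 0 \<le> 1/2 then p (s(0 := 2 * s 0)) else q (s(0 := 2 * s 0 - 1)))"

text \<open>
  Operations on classes are unions over representatives; by homotopy invariance all the classes in
  such a union coincide.
\<close>

definition homotopy_group :: "nat \<Rightarrow> 'a topology \<Rightarrow> 'a \<Rightarrow> ((nat \<Rightarrow> real) \<Rightarrow> 'a) set monoid" where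
  "homotopy_group n X x0 =
     \<lparr>carrier = spheroid_class n X x0 ` spheroids n X x0,
      mult = (\<lambda>A B. \<Union>p\<in>A. \<Union>q\<in>B. spheroid_class n X x0 (spheroid_mult n p q)),
      one = spheroid_class n X x0 (\<lambda>s\<in>topspace (cube n). x0)\<rparr>"

definition homotopy_group_map ::
    "nat \<Rightarrow> 'b topology \<Rightarrow> 'b \<Rightarrow> ('a \<Rightarrow> 'b) \<Rightarrow>
     ((nat \<Rightarrow> real) \<Rightarrow> 'a) set \<Rightarrow> ((nat \<Rightarrow> real) \<Rightarrow> 'b) set" where
  "homotopy_group_map n Y y0 k A =
     (\<Union>p\<in>A. spheroid_class n Y y0 (restrict (k \<circ> p) (topspace (cube n))))"

text \<open>
  \<open>evaluation_subgroup n V U g u0\<close> is $G_n(V,U;g)$, where \<open>u0\<close> is the base point of \<open>U\<close>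
  and \<open>g u0\<close> that of \<open>V\<close>.
\<close>

definition evaluation_subgroup ::
    "nat \<Rightarrow> 'b topology \<Rightarrow> 'a topology \<Rightarrow> ('a \<Rightarrow> 'b) \<Rightarrow> 'a \<Rightarrow>
     ((nat \<Rightarrow> real) \<Rightarrow> 'b) set monoid" where
  "evaluation_subgroup n V U g u0 =
     (homotopy_group n V (g u0))
       \<lparr>carrier := homotopy_group_map n V (g u0) (\<lambda>h. h u0) `
          carrier (homotopy_group n (map_component U V g) (restrict g (topspace U)))\<rparr>"

definition gottlieb_group ::
    "nat \<Rightarrow> 'a topology \<Rightarrow> 'a \<Rightarrow> ((nat \<Rightarrow> real) \<Rightarrow> 'a) set monoid" where
  "gottlieb_group n V v0 = evaluation_subgroup n V V (\<lambda>v. v) v0"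

definition circle :: "complex topology" where
  "circle = top_of_set (sphere 0 1)"

abbreviation circle_base :: complex where
  "circle_base \<equiv> 1"

definition const_loop :: "'a \<Rightarrow> complex \<Rightarrow> 'a" where
  "const_loop x = (\<lambda>z\<in>topspace circle. x)"

definition free_loop_space :: "'a topology \<Rightarrow> 'a \<Rightarrow> (complex \<Rightarrow> 'a) topology" where
  "free_loop_space Y y0 = map_component circle Y (const_loop y0)"

definition relative_free_loop_space ::
    "'a topology \<Rightarrow> 'b topology \<Rightarrow> ('a \<Rightarrow> 'b) \<Rightarrow> 'b \<Rightarrow> ('a \<times> (complex \<Rightarrow> 'b)) topology" where
  "relative_free_loop_space X Y f y0 =
     subtopology (prod_topology X (free_loop_space Y y0)) {(x, \<gamma>). f x = \<gamma> circle_base}"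

definition whisker_map :: "('a \<Rightarrow> 'b) \<Rightarrow> (complex \<Rightarrow> 'a) \<Rightarrow> 'a \<times> (complex \<Rightarrow> 'b)" where
  "whisker_map f \<alpha> = (\<alpha> circle_base, restrict (f \<circ> \<alpha>) (topspace circle))"

end

theory Submission
  imports Defs "HOL-Algebra.Coset"
begin

text \<open>
  Write \<open>L\<close> for the pullback of \<open>\<Lambda>Y \<rightarrow> Y\<close> along \<open>f\<close>.  The projection \<open>L \<rightarrow> X\<close> is a fibration whose
  fibre consists of the null-homotopic loops of \<open>\<Omega>Y\<close>, and constant loops give a section \<open>x \<mapsto> (x, const (f x))\<close>.  Hence
  \<open>\<pi>\<^sub>n(L) \<cong> \<pi>\<^sub>n(X) \<times> \<pi>\<^sub>n\<^sub>+\<^sub>1(Y)\<close>, and the point is that this isomorphism matches the evaluation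
  subgroup of \<open>\<phi>\<close> with the product of the two others.

  For the matching, the isomorphism has to be written by formulas on representatives that also make
  sense for families of spheroids parametrized by \<open>X\<close>.  A spheroid of \<open>L\<close> is a pair \<open>(\<alpha>, \<beta>)\<close>, where
  \<open>\<beta> s\<close> is a loop at \<open>f (\<alpha> s)\<close>.  The first component of the isomorphism is \<open>[\<alpha>]\<close>.  The second should
  be the difference between \<open>\<beta>\<close> and the constant loops at \<open>f \<circ> \<alpha>\<close>.  It is represented by the
  spheroid \<open>unloop n \<beta>\<close> of dimension \<open>n + 1\<close>, which juxtaposes \<open>\<beta>\<close>, read as a map of one more
  variable, with the reversed family of constant loops, and then closes up the two faces on which
  the new variable is \<open>0\<close> or \<open>1\<close>: there the values trace \<open>f \<circ> \<alpha>\<close> forwards and then backwards,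
  which can be contracted within the formula.  The juxtaposition uses coordinate \<open>1\<close>, while the
  groups are multiplied in coordinate \<open>0\<close>, so the resulting map \<open>splitting\<close> is a homomorphism by an
  equality of functions; this is where \<open>n \<ge> 2\<close> enters.

  The map is injective (\<open>splitting_kernel\<close>): a contraction of \<open>\<alpha>\<close> conjugates the loops \<open>\<beta> s\<close> into based
  loops (\<open>straighten_loops\<close>), that is, \<open>\<beta>\<close> becomes \<open>looping n b\<close> for a spheroid \<open>b\<close> of \<open>Y\<close>, and \<open>unloop\<close>
  undoes \<open>looping\<close> up to homotopy (\<open>unloop_looping\<close>), so that \<open>b\<close> is trivial.

  It remains to compare the subgroups.  A spheroid of maps \<open>\<Lambda>X \<rightarrow> L\<close>, based at \<open>\<phi>\<close>, restricts
  to constant loops, and the same two formulas, applied for every \<open>x\<close> in \<open>X\<close>, give maps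
  \<open>I\<^sup>n \<times> X \<rightarrow> X\<close> and \<open>I\<^sup>n\<^sup>+\<^sup>1 \<times> X \<rightarrow> Y\<close> that exhibit both components as elements of the evaluation
  subgroups (\<open>splitting_evaluation_subgroup\<close>).  Conversely, \<open>F : I\<^sup>n \<times> X \<rightarrow> X\<close> induces
  \<open>(s, \<gamma>) \<mapsto> (F (s, \<gamma> 1), f \<circ> F (s, \<gamma> -))\<close>, and \<open>F : I\<^sup>n\<^sup>+\<^sup>1 \<times> X \<rightarrow> Y\<close> induces
  \<open>(s, \<gamma>) \<mapsto> (\<gamma> 1, t \<mapsto> F (s, t, \<gamma> t))\<close>; these realize the two factors
  (\<open>gottlieb_in_splitting_image\<close>, \<open>evaluation_in_splitting_image\<close>).

  The space \<open>\<Lambda>X\<close> is in general not locally compact, so a continuous map \<open>I\<^sup>n \<rightarrow> map(\<Lambda>X, L)\<close> need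
  not have a continuous adjoint \<open>I\<^sup>n \<times> \<Lambda>X \<rightarrow> L\<close>.  Only its restriction along \<open>X \<rightarrow> \<Lambda>X\<close> is uncurried, which is
  legitimate because \<open>X\<close> is locally compact and Hausdorff.
\<close>

section \<open>The compact-open topology\<close>

abbreviation unit_interval :: "real topology" where
  "unit_interval \<equiv> top_of_set {0..1}"

text \<open>
  The tube lemma in the form in which it proves continuity into a mapping space.
\<close>

lemma openin_all_compact:
  assumes W: "openin (prod_topology Z U) W" and K: "compactin U K"
  shows "openin Z {z \<in> topspace Z. \<forall>u\<in>K. (z, u) \<in> W}"
proof (subst openin_subopen, clarify)
  fix z assume z: "z \<in> topspace Z" "\<forall>u\<in>K. (z, u) \<in> W"
  then obtain N V where "openin Z N" "z \<in> N" "K \<subseteq> V" "N \<times> V \<subseteq> W"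
    using tube_lemma_right[OF W K z(1)] by blast
  then show "\<exists>T. openin Z T \<and> z \<in> T \<and> T \<subseteq> {z \<in> topspace Z. \<forall>u\<in>K. (z, u) \<in> W}"
    using openin_subset by (intro exI[of _ N]) blast
qed

lemma continuous_map_into_compact_open:
  assumes cts: "\<And>z. z \<in> topspace Z \<Longrightarrow> continuous_map U V (G z)"
    and ext: "\<And>z. z \<in> topspace Z \<Longrightarrow> G z \<in> extensional (topspace U)"
    and op: "\<And>K W. compactin U K \<Longrightarrow> openin V W \<Longrightarrow> openin Z {z \<in> topspace Z. G z ` K \<subseteq> W}"
  shows "continuous_map Z (compact_open_topology U V) G"
  unfolding compact_open_topology_def
proof (rule continuous_on_generated_topo)
  show "G ` topspace Z \<subseteq> \<Union>{{g. continuous_map U V g \<and> g \<in> extensional (topspace U) \<and> g ` K \<subseteq> W} |K W.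
               compactin U K \<and> openin V W}"
    using topspace_compact_open_topology[of U V] cts ext
    unfolding compact_open_topology_def by auto
  fix S assume "S \<in> {{g. continuous_map U V g \<and> g \<in> extensional (topspace U) \<and> g ` K \<subseteq> W} |K W.
               compactin U K \<and> openin V W}"
  then obtain K W where S: "S = {g. continuous_map U V g \<and> g \<in> extensional (topspace U) \<and> g ` K \<subseteq> W}"
    and K: "compactin U K" and W: "openin V W" by blast
  have "G -` S \<inter> topspace Z = {z \<in> topspace Z. G z ` K \<subseteq> W}"
    using cts ext unfolding S by auto
  then show "openin Z (G -` S \<inter> topspace Z)"
    using op[OF K W] by simp
qed

lemma continuous_map_curry:
  assumes F: "continuous_map (prod_topology Z U) V F"
  shows "continuous_map Z (compact_open_topology U V) (\<lambda>z. \<lambda>u\<in>topspace U. F (z, u))"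
proof (rule continuous_map_into_compact_open)
  fix z assume z: "z \<in> topspace Z"
  have "continuous_map U V (F \<circ> Pair z)"
    by (rule continuous_map_o_Pair[OF F z])
  then show "continuous_map U V (\<lambda>u\<in>topspace U. F (z, u))"
    by (rule continuous_map_eq) auto
next
  fix K W assume K: "compactin U K" and W: "openin V W"
  have KU: "K \<subseteq> topspace U" using K by (rule compactin_subset_topspace)
  have "openin Z {z \<in> topspace Z. \<forall>u\<in>K. (z, u) \<in> {p \<in> topspace (prod_topology Z U). F p \<in> W}}"
    by (rule openin_all_compact[OF openin_continuous_map_preimage[OF F W] K])
  moreover have "{z \<in> topspace Z. \<forall>u\<in>K. (z, u) \<in> {p \<in> topspace (prod_topology Z U). F p \<in> W}}
      = {z \<in> topspace Z. (\<lambda>u\<in>topspace U. F (z, u)) ` K \<subseteq> W}"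
    using KU by auto
  ultimately show "openin Z {z \<in> topspace Z. (\<lambda>u\<in>topspace U. F (z, u)) ` K \<subseteq> W}" by simp
qed auto

lemma continuous_map_compact_open_mem:
  assumes "continuous_map Z (compact_open_topology U V) G" "z \<in> topspace Z"
  shows "continuous_map U V (G z)" "G z \<in> extensional (topspace U)"
  using continuous_map_image_subset_topspace[OF assms(1)] assms(2)
  by (auto simp: topspace_compact_open_topology)

lemma openin_compact_open_subbasic:
  assumes "compactin U K" "openin V W"
  shows "openin (compact_open_topology U V)
     {g. continuous_map U V g \<and> g \<in> extensional (topspace U) \<and> g ` K \<subseteq> W}"
  unfolding compact_open_topology_def
  by (rule topology_generated_by_Basis) (use assms in blast)

text \<open>
  If \<open>g u\<close> lies in the open set \<open>W\<close> and \<open>K\<close> is a compact neighbourhood of \<open>u\<close> that \<open>g\<close> maps into \<open>W\<close>,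
  then every map close to \<open>g\<close>, in the sense of the subbasic set for \<open>K\<close> and \<open>W\<close>, still maps all points
  near \<open>u\<close> into \<open>W\<close>.
\<close>

lemma continuous_map_compact_open_eval:
  assumes nb: "neighbourhood_base_of (compactin U) U"
  shows "continuous_map (prod_topology (compact_open_topology U V) U) V (\<lambda>(g, u). g u)"
  unfolding continuous_map_eq_topcontinuous_at
proof
  fix p assume "p \<in> topspace (prod_topology (compact_open_topology U V) U)"
  then obtain g u where p: "p = (g, u)" and g: "continuous_map U V g" "g \<in> extensional (topspace U)"
    and u: "u \<in> topspace U"
    by (auto simp: topspace_compact_open_topology)
  show "topcontinuous_at (prod_topology (compact_open_topology U V) U) V (\<lambda>(g, u). g u) p"
    unfolding topcontinuous_at_def
  proof (intro conjI allI impI)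
    show "p \<in> topspace (prod_topology (compact_open_topology U V) U)" by fact
    show "(\<lambda>(g, u). g u) \<in> topspace (prod_topology (compact_open_topology U V) U) \<rightarrow> topspace V"
      by (auto simp: topspace_compact_open_topology continuous_map_def)
    fix W assume W: "openin V W \<and> (case p of (g, u) \<Rightarrow> g u) \<in> W"
    have "openin U {x \<in> topspace U. g x \<in> W}"
      using openin_continuous_map_preimage[OF g(1)] W by blast
    moreover have "u \<in> {x \<in> topspace U. g x \<in> W}" using u W p by auto
    ultimately obtain N K where N: "openin U N" "compactin U K" "u \<in> N" "N \<subseteq> K"
        "K \<subseteq> {x \<in> topspace U. g x \<in> W}"
      using nb unfolding neighbourhood_base_of by meson
    let ?S = "{g. continuous_map U V g \<and> g \<in> extensional (topspace U) \<and> g ` K \<subseteq> W}"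
    have "openin (compact_open_topology U V) ?S"
      by (rule openin_compact_open_subbasic[OF N(2)]) (use W in blast)
    then have "openin (prod_topology (compact_open_topology U V) U) (?S \<times> N)"
      using N(1) by (simp add: openin_prod_Times_iff)
    then show "\<exists>S. openin (prod_topology (compact_open_topology U V) U) S \<and> p \<in> S \<and>
                 (\<forall>y\<in>S. (case y of (g, u) \<Rightarrow> g u) \<in> W)"
      using p g N by (intro exI[of _ "?S \<times> N"]) auto
  qed
qed

lemma continuous_map_uncurry:
  assumes nb: "neighbourhood_base_of (compactin U) U"
    and G: "continuous_map Z (compact_open_topology U V) G"
    and z: "continuous_map S Z \<zeta>" and u: "continuous_map S U \<upsilon>"
  shows "continuous_map S V (\<lambda>s. G (\<zeta> s) (\<upsilon> s))"
proof -
  have "continuous_map S (prod_topology (compact_open_topology U V) U) (\<lambda>s. (G (\<zeta> s), \<upsilon> s))"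
    using continuous_map_compose[OF z G] u by (simp add: continuous_map_paired o_def)
  from continuous_map_compose[OF this continuous_map_compact_open_eval[OF nb]]
  show ?thesis by (simp add: o_def)
qed

lemma compact_neighbourhoods_if_locally_compact_Hausdorff:
  assumes "locally_compact_space U" "Hausdorff_space U"
  shows "neighbourhood_base_of (compactin U) U"
  using assms locally_compact_kc_space by blast

lemma continuous_map_compact_open_eval_point:
  assumes u: "u \<in> topspace U"
  shows "continuous_map (compact_open_topology U V) V (\<lambda>g. g u)"
  unfolding continuous_map_def
proof (intro conjI allI impI)
  show "(\<lambda>g. g u) \<in> topspace (compact_open_topology U V) \<rightarrow> topspace V"
    using u by (auto simp: topspace_compact_open_topology continuous_map_def)
  fix W assume W: "openin V W"
  have "openin (compact_open_topology U V)
      {g. continuous_map U V g \<and> g \<in> extensional (topspace U) \<and> g ` {u} \<subseteq> W}"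
    by (rule openin_compact_open_subbasic) (use u W in auto)
  also have "{g. continuous_map U V g \<and> g \<in> extensional (topspace U) \<and> g ` {u} \<subseteq> W}
      = {g \<in> topspace (compact_open_topology U V). g u \<in> W}"
    by (auto simp: topspace_compact_open_topology)
  finally show "openin (compact_open_topology U V) {g \<in> topspace (compact_open_topology U V). g u \<in> W}" .
qed

lemma continuous_map_compact_open_precompose:
  assumes c: "continuous_map U' U c"
  shows "continuous_map (compact_open_topology U V) (compact_open_topology U' V)
           (\<lambda>g. restrict (g \<circ> c) (topspace U'))"
proof (rule continuous_map_into_compact_open)
  fix g assume "g \<in> topspace (compact_open_topology U V)"
  then have "continuous_map U' V (g \<circ> c)"
    using continuous_map_compose[OF c] by (auto simp: topspace_compact_open_topology)
  then show "continuous_map U' V (restrict (g \<circ> c) (topspace U'))"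
    by (rule continuous_map_eq) auto
next
  fix K W assume K: "compactin U' K" and W: "openin V W"
  have KU: "K \<subseteq> topspace U'" using K by (rule compactin_subset_topspace)
  have "openin (compact_open_topology U V)
      {g. continuous_map U V g \<and> g \<in> extensional (topspace U) \<and> g ` (c ` K) \<subseteq> W}"
    by (rule openin_compact_open_subbasic) (use image_compactin[OF K c] W in auto)
  also have "{g. continuous_map U V g \<and> g \<in> extensional (topspace U) \<and> g ` (c ` K) \<subseteq> W}
      = {g \<in> topspace (compact_open_topology U V). restrict (g \<circ> c) (topspace U') ` K \<subseteq> W}"
    using KU by (auto simp: topspace_compact_open_topology image_subset_iff)
  finally show "openin (compact_open_topology U V) \<dots>" .
qed auto

section \<open>Loops as maps on the unit interval\<close>

definition circle_exp :: "real \<Rightarrow> complex" where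
  "circle_exp t = cis (2 * pi * t)"

definition circle_arg :: "complex \<Rightarrow> real" where
  "circle_arg w = Arg2pi w / (2 * pi)"

lemma topspace_circle [simp]: "topspace circle = sphere 0 1"
  by (simp add: circle_def)

lemma circle_exp_0 [simp]: "circle_exp 0 = 1" and circle_exp_1 [simp]: "circle_exp 1 = 1"
  by (simp_all add: circle_exp_def)

lemma circle_exp_mem: "circle_exp t \<in> sphere 0 1"
  by (simp add: circle_exp_def)

lemma circle_exp_arg: "w \<in> sphere 0 1 \<Longrightarrow> circle_exp (circle_arg w) = w"
  using complex_norm_eq_1_exp[of w] by (simp add: circle_exp_def circle_arg_def cis_conv_exp)

lemma circle_arg_bounds: "0 \<le> circle_arg w" "circle_arg w < 1"
  using Arg2pi[of w] by (auto simp: circle_arg_def field_simps)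

lemma circle_arg_mem: "circle_arg w \<in> {0..1}"
  using circle_arg_bounds[of w] by simp

lemma circle_arg_exp: 
  assumes "0 \<le> t" "t < 1" shows "circle_arg (circle_exp t) = t"
proof -
  have "Arg2pi (exp (\<i> * complex_of_real (2 * pi * t))) = Im (\<i> * complex_of_real (2 * pi * t))"
    by (rule Arg2pi_exp) (use assms in auto)
  then show ?thesis by (simp add: circle_arg_def circle_exp_def cis_conv_exp)
qed

lemma circle_arg_1 [simp]: "circle_arg 1 = 0"
  using circle_arg_exp[of 0] by simp

lemma continuous_map_circle_exp: "continuous_map unit_interval circle circle_exp"
proof -
  have "continuous_on {0..1} circle_exp"
    unfolding circle_exp_def by (intro continuous_intros)
  then show ?thesis
    using circle_exp_mem by (simp add: circle_def continuous_map_in_subtopology Pi_iff)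
qed

lemma quotient_map_circle_exp: "quotient_map unit_interval circle circle_exp"
proof (rule continuous_imp_quotient_map[OF continuous_map_circle_exp])
  show "Hausdorff_space circle" by (simp add: circle_def Hausdorff_space_subtopology)
  have "w \<in> circle_exp ` {0..1}" if "w \<in> sphere 0 1" for w
    using circle_exp_arg[OF that] circle_arg_mem[of w] by (metis image_eqI)
  then show "circle_exp ` topspace unit_interval = topspace circle"
    using circle_exp_mem by auto
qed (simp add: compact_space_subtopology)

lemma neighbourhood_base_circle: "neighbourhood_base_of (compactin circle) circle"
proof (rule compact_neighbourhoods_if_locally_compact_Hausdorff)
  show "locally_compact_space circle"
    by (rule compact_imp_locally_compact_space) (simp add: circle_def compact_space_subtopology)
qed (simp add: circle_def Hausdorff_space_subtopology)

lemma glue_circle_arg: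
  assumes "G (z, 0) = G (z, 1)" "t \<in> {0..1}"
  shows "G (z, circle_arg (circle_exp t)) = G (z, t)"
proof (cases "t = 1")
  case False then show ?thesis using assms by (simp add: circle_arg_exp)
qed (use assms in simp)

text \<open>
  The loop space carries the topology induced from the maps on the interval: a compact subset of the circle pulls back to a compact subset of the interval, so the condition that
  a compact set of the circle goes into an open set is a condition of the same kind on the interval,
  where the tube lemma applies.
\<close>

lemma continuous_map_into_loops:
  assumes G: "continuous_map (prod_topology Z unit_interval) V G"
    and closed: "\<And>z. z \<in> topspace Z \<Longrightarrow> G (z, 0) = G (z, 1)"
  shows "continuous_map Z (compact_open_topology circle V)
           (\<lambda>z. \<lambda>w\<in>topspace circle. G (z, circle_arg w))"
proof (rule continuous_map_into_compact_open)
  fix z assume z: "z \<in> topspace Z"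
  have "continuous_map circle V (\<lambda>w. G (z, circle_arg w))"
  proof (rule continuous_compose_quotient_map[OF quotient_map_circle_exp])
    show "continuous_map unit_interval V ((\<lambda>w. G (z, circle_arg w)) \<circ> circle_exp)"
      using continuous_map_o_Pair[OF G z]
      by (rule continuous_map_eq) (simp add: glue_circle_arg closed z)
  qed
  then show "continuous_map circle V (\<lambda>w\<in>topspace circle. G (z, circle_arg w))"
    by (rule continuous_map_eq) auto
next
  fix K W assume K: "compactin circle K" and W: "openin V W"
  have KU: "K \<subseteq> sphere 0 1" using compactin_subset_topspace[OF K] by simp
  have "closedin circle K"
    using K by (rule compactin_imp_closedin[rotated]) (simp add: circle_def Hausdorff_space_subtopology)
  then have "closedin unit_interval {t \<in> topspace unit_interval. circle_exp t \<in> K}"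
    by (rule closedin_continuous_map_preimage[OF continuous_map_circle_exp])
  then have K': "compactin unit_interval {t \<in> topspace unit_interval. circle_exp t \<in> K}"
    by (rule closedin_compact_space[rotated]) (simp add: compact_space_subtopology)
  have "openin Z {z \<in> topspace Z. \<forall>u\<in>{t \<in> topspace unit_interval. circle_exp t \<in> K}.
       (z, u) \<in> {p \<in> topspace (prod_topology Z unit_interval). G p \<in> W}}" (is "openin Z ?L")
    by (rule openin_all_compact[OF openin_continuous_map_preimage[OF G W] K'])
  moreover have "?L = {z \<in> topspace Z. (\<lambda>w\<in>topspace circle. G (z, circle_arg w)) ` K \<subseteq> W}" (is "_ = ?R")
  proof (intro equalityI subsetI)
    fix z assume z: "z \<in> ?L"
    have "G (z, circle_arg w) \<in> W" if "w \<in> K" for w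
      using z that KU circle_arg_mem[of w] circle_exp_arg[of w] by auto
    then show "z \<in> ?R" using z KU by auto
  next
    fix z assume z: "z \<in> ?R"
    have "G (z, t) \<in> W" if "t \<in> {0..1}" "circle_exp t \<in> K" for t
    proof -
      have "G (z, circle_arg (circle_exp t)) \<in> W" using z that circle_exp_mem[of t] by auto
      then show ?thesis using glue_circle_arg[of G z t] closed z that by auto
    qed
    then show "z \<in> ?L" using z by auto
  qed
  ultimately show "openin Z ?R" by simp
qed auto

section \<open>Spheroids and their homotopies\<close>

lemma topspace_cube: "topspace (cube n) = PiE {..<n} (\<lambda>_. {0..1})"
  by (simp add: cube_def)

lemma cube_coord: "s \<in> topspace (cube n) \<Longrightarrow> i < n \<Longrightarrow> 0 \<le> s i \<and> s i \<le> 1"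
  by (auto simp: topspace_cube PiE_iff)

lemma cube_update:
  "s \<in> topspace (cube n) \<Longrightarrow> i < n \<Longrightarrow> 0 \<le> c \<Longrightarrow> c \<le> 1 \<Longrightarrow> s(i := c) \<in> topspace (cube n)"
  by (auto simp: topspace_cube PiE_iff extensional_def)

lemma cube_boundary_update:
  "s \<in> topspace (cube n) \<Longrightarrow> i < n \<Longrightarrow> c = 0 \<or> c = 1 \<Longrightarrow> s(i := c) \<in> cube_boundary n"
  using cube_update[of s n i c] by (auto simp: cube_boundary_def)

lemma cube_boundary_update_other:
  assumes "s \<in> cube_boundary n" "i < n" "0 \<le> c" "c \<le> 1" "s i \<noteq> 0" "s i \<noteq> 1"
  shows "s(i := c) \<in> cube_boundary n"
proof -
  obtain j where "j < n" "s j = 0 \<or> s j = 1" "s \<in> topspace (cube n)"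
    using assms by (auto simp: cube_boundary_def)
  then show ?thesis
    using cube_update[of s n i c] assms by (auto simp: cube_boundary_def intro!: exI[of _ j])
qed

lemma cube_boundary_subset: "s \<in> cube_boundary n \<Longrightarrow> s \<in> topspace (cube n)"
  by (simp add: cube_boundary_def)

lemma continuous_map_coordinate:
  assumes "continuous_map Z (cube n) \<sigma>" "i < n"
  shows "continuous_map Z euclideanreal (\<lambda>z. \<sigma> z i)"
proof -
  have "continuous_map Z unit_interval (\<lambda>z. \<sigma> z i)"
    using assms unfolding cube_def by (auto simp: continuous_map_componentwise)
  then show ?thesis by (rule continuous_map_into_fulltopology)
qed

lemma continuous_map_into_unit_interval:
  assumes "continuous_map Z euclideanreal \<phi>" "\<And>z. z \<in> topspace Z \<Longrightarrow> 0 \<le> \<phi> z \<and> \<phi> z \<le> 1"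
  shows "continuous_map Z unit_interval \<phi>"
  using assms by (auto simp: continuous_map_in_subtopology)

lemma continuous_map_cube_update:
  assumes \<sigma>: "continuous_map Z (cube n) \<sigma>" and "continuous_map Z euclideanreal \<phi>"
    and "\<And>z. z \<in> topspace Z \<Longrightarrow> 0 \<le> \<phi> z \<and> \<phi> z \<le> 1" "i < n"
  shows "continuous_map Z (cube n) (\<lambda>z. (\<sigma> z)(i := \<phi> z))"
proof -
  have "continuous_map Z unit_interval \<phi>"
    by (rule continuous_map_into_unit_interval) (use assms in auto)
  moreover have "continuous_map Z unit_interval (\<lambda>z. \<sigma> z j)" if "j < n" for j
    using \<sigma> that unfolding cube_def by (auto simp: continuous_map_componentwise)
  moreover have "(\<sigma> z)(i := \<phi> z) \<in> extensional {..<n}" if "z \<in> topspace Z" for z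
    using \<sigma> that \<open>i < n\<close> unfolding cube_def
    by (auto simp: continuous_map_componentwise extensional_def image_subset_iff)
  ultimately have "continuous_map Z unit_interval (\<lambda>z. ((\<sigma> z)(i := \<phi> z)) j)" if "j < n" for j
    using that by (cases "j = i") auto
  then show ?thesis
    using \<open>\<And>z. z \<in> topspace Z \<Longrightarrow> (\<sigma> z)(i := \<phi> z) \<in> extensional {..<n}\<close>
    unfolding cube_def by (auto simp: continuous_map_componentwise)
qed

lemma continuous_map_unit_interval_real:
  "continuous_map Z unit_interval \<phi> \<Longrightarrow> continuous_map Z euclideanreal \<phi>"
  by (rule continuous_map_into_fulltopology)

abbreviation spheroid_homotopic ::
    "nat \<Rightarrow> 'a topology \<Rightarrow> 'a \<Rightarrow> ((nat \<Rightarrow> real) \<Rightarrow> 'a) \<Rightarrow> ((nat \<Rightarrow> real) \<Rightarrow> 'a) \<Rightarrow> bool" where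
  "spheroid_homotopic n X x0 \<equiv> homotopic_with (\<lambda>h. \<forall>s\<in>cube_boundary n. h s = x0) (cube n) X"

lemma spheroid_homotopic_iff:
  "spheroid_homotopic n X x0 p q \<longleftrightarrow>
     (\<exists>H. continuous_map (prod_topology unit_interval (cube n)) X H \<and>
          (\<forall>s\<in>topspace (cube n). H (0, s) = p s) \<and> (\<forall>s\<in>topspace (cube n). H (1, s) = q s) \<and>
          (\<forall>u\<in>{0..1}. \<forall>s\<in>cube_boundary n. H (u, s) = x0))"
  by (rule homotopic_with) (metis cube_boundary_subset)

lemma spheroid_homotopicI:
  assumes "continuous_map (prod_topology unit_interval (cube n)) X H"
    and "\<And>s. s \<in> topspace (cube n) \<Longrightarrow> H (0, s) = p s"
    and "\<And>s. s \<in> topspace (cube n) \<Longrightarrow> H (1, s) = q s"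
    and "\<And>u s. 0 \<le> u \<Longrightarrow> u \<le> 1 \<Longrightarrow> s \<in> cube_boundary n \<Longrightarrow> H (u, s) = x0"
  shows "spheroid_homotopic n X x0 p q"
  unfolding spheroid_homotopic_iff using assms by (intro exI[of _ H]) auto

lemma spheroid_homotopicE:
  assumes "spheroid_homotopic n X x0 p q"
  obtains H where "continuous_map (prod_topology unit_interval (cube n)) X H"
    "\<And>s. s \<in> topspace (cube n) \<Longrightarrow> H (0, s) = p s"
    "\<And>s. s \<in> topspace (cube n) \<Longrightarrow> H (1, s) = q s"
    "\<And>u s. 0 \<le> u \<Longrightarrow> u \<le> 1 \<Longrightarrow> s \<in> cube_boundary n \<Longrightarrow> H (u, s) = x0"
  using assms unfolding spheroid_homotopic_iff by auto

lemma spheroids_iff: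
  "p \<in> spheroids n X x0 \<longleftrightarrow> spheroid_homotopic n X x0 p p \<and> p \<in> extensional (topspace (cube n))"
  by (auto simp: spheroids_def)

lemma spheroids_restrictI:
  assumes "continuous_map (cube n) X p" "\<And>s. s \<in> cube_boundary n \<Longrightarrow> p s = x0"
  shows "restrict p (topspace (cube n)) \<in> spheroids n X x0"
proof -
  have "continuous_map (cube n) X (restrict p (topspace (cube n)))"
    using assms(1) by (rule continuous_map_eq) simp
  then show ?thesis
    using assms(2) by (auto simp: spheroids_def dest: cube_boundary_subset)
qed

lemma spheroidsD:
  assumes "p \<in> spheroids n X x0"
  shows "continuous_map (cube n) X p" "p \<in> extensional (topspace (cube n))"
    "\<And>s. s \<in> cube_boundary n \<Longrightarrow> p s = x0" "spheroid_homotopic n X x0 p p"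
  using assms by (auto simp: spheroids_def)

lemma spheroid_class_eq_iff:
  assumes "p \<in> spheroids n X x0" "q \<in> spheroids n X x0"
  shows "spheroid_class n X x0 p = spheroid_class n X x0 q \<longleftrightarrow> spheroid_homotopic n X x0 p q"
proof
  assume "spheroid_class n X x0 p = spheroid_class n X x0 q"
  moreover have "q \<in> spheroid_class n X x0 q"
    using assms spheroidsD by (auto simp: spheroid_class_def)
  ultimately show "spheroid_homotopic n X x0 p q" by (auto simp: spheroid_class_def)
next
  assume "spheroid_homotopic n X x0 p q"
  then show "spheroid_class n X x0 p = spheroid_class n X x0 q"
    unfolding spheroid_class_def by (blast intro: homotopic_with_trans homotopic_with_symD)
qed

lemma spheroid_class_mono:
  "spheroid_homotopic n X x0 p q \<Longrightarrow> spheroid_class n X x0 p = spheroid_class n X x0 q"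
  unfolding spheroid_class_def by (blast intro: homotopic_with_trans homotopic_with_symD)

lemma spheroid_class_self: "p \<in> spheroids n X x0 \<Longrightarrow> p \<in> spheroid_class n X x0 p"
  using spheroidsD by (auto simp: spheroid_class_def)

lemma spheroid_class_memD:
  assumes "q \<in> spheroid_class n X x0 p"
  shows "q \<in> spheroids n X x0" "spheroid_homotopic n X x0 p q"
  using assms by (auto simp: spheroid_class_def)

lemma spheroid_reparametrize:
  assumes p: "p \<in> spheroids n X x0"
    and \<Phi>: "continuous_map (prod_topology unit_interval (cube m)) (cube n) \<Phi>"
    and bd: "\<And>u s. 0 \<le> u \<Longrightarrow> u \<le> 1 \<Longrightarrow> s \<in> cube_boundary m \<Longrightarrow> p (\<Phi> (u, s)) = x0"
    and "\<And>s. s \<in> topspace (cube m) \<Longrightarrow> q s = p (\<Phi> (0, s))"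
    and "\<And>s. s \<in> topspace (cube m) \<Longrightarrow> r s = p (\<Phi> (1, s))"
  shows "spheroid_homotopic m X x0 q r"
  by (rule spheroid_homotopicI[where H = "p \<circ> \<Phi>"])
    (use assms continuous_map_compose[OF \<Phi> spheroidsD(1)[OF p]] in auto)

text \<open>
  The straight-line homotopy from \<open>\<phi>\<close> to \<open>\<psi>\<close> keeps both faces of coordinate \<open>i\<close> inside faces, because
  \<open>\<phi>\<close> and \<open>\<psi>\<close> agree at both ends of the interval and take them to ends.  All group laws up to homotopy, except
  commutativity, are instances.
\<close>

lemma spheroid_reparametrize_coordinate:
  assumes p: "p \<in> spheroids n X x0" and i: "i < n"
    and \<phi>: "continuous_on {0..1} \<phi>" "\<phi> \<in> {0..1} \<rightarrow> {0..1}"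
    and \<psi>: "continuous_on {0..1} \<psi>" "\<psi> \<in> {0..1} \<rightarrow> {0..1}"
    and ends: "\<phi> 0 = \<psi> 0" "\<phi> 1 = \<psi> 1" "\<phi> 0 \<in> {0, 1}" "\<phi> 1 \<in> {0, 1::real}"
    and q: "\<And>s. s \<in> topspace (cube n) \<Longrightarrow> q s = p (s(i := \<phi> (s i)))"
    and r: "\<And>s. s \<in> topspace (cube n) \<Longrightarrow> r s = p (s(i := \<psi> (s i)))"
  shows "spheroid_homotopic n X x0 q r"
proof (rule spheroid_reparametrize[OF p])
  let ?D = "prod_topology unit_interval (cube n)"
  let ?\<Phi> = "\<lambda>(u, s). s(i := (1 - u) * \<phi> (s i) + u * \<psi> (s i))"
  have convex: "0 \<le> (1 - u) * \<phi> x + u * \<psi> x \<and> (1 - u) * \<phi> x + u * \<psi> x \<le> 1"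
    if "0 \<le> u" "u \<le> 1" "0 \<le> x" "x \<le> 1" for u x
  proof -
    have "\<phi> x \<in> {0..1}" "\<psi> x \<in> {0..1}" using \<phi> \<psi> that by auto
    then show ?thesis using that by (auto intro!: convex_bound_le)
  qed
  have u: "continuous_map ?D euclideanreal fst"
    by (rule continuous_map_unit_interval_real[OF continuous_map_fst])
  have s: "continuous_map ?D euclideanreal (\<lambda>z. snd z i)"
    by (rule continuous_map_coordinate[OF continuous_map_snd i])
  then have si: "continuous_map ?D unit_interval (\<lambda>z. snd z i)"
    by (rule continuous_map_into_unit_interval) (use cube_coord i in auto)
  have fs: "continuous_map ?D euclideanreal (\<lambda>z. \<phi> (snd z i))"
    "continuous_map ?D euclideanreal (\<lambda>z. \<psi> (snd z i))"
    using continuous_map_compose[OF si, of euclideanreal] \<phi>(1) \<psi>(1) by (auto simp: o_def)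
  have "continuous_map ?D euclideanreal (\<lambda>z. (1 - fst z) * \<phi> (snd z i) + fst z * \<psi> (snd z i))"
    by (intro continuous_intros u fs) auto
  then show "continuous_map ?D (cube n) ?\<Phi>"
    unfolding case_prod_unfold
    by (intro continuous_map_cube_update continuous_map_snd i) (use convex cube_coord[OF _ i] in auto)
  fix u :: real and s assume u: "0 \<le> u" "u \<le> 1" and s: "s \<in> cube_boundary n"
  have "?\<Phi> (u, s) \<in> cube_boundary n"
  proof (cases "s i = 0 \<or> s i = 1")
    case True
    have "(1 - u) * \<phi> 0 + u * \<psi> 0 = \<phi> 0" "(1 - u) * \<phi> 1 + u * \<psi> 1 = \<phi> 1"
      using ends(1,2) by (simp_all add: algebra_simps)
    then show ?thesis
      using True ends cube_boundary_update[OF cube_boundary_subset[OF s] i] by auto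
  next
    case False
    then show ?thesis
      using s i u convex[of u "s i"] cube_coord[OF cube_boundary_subset[OF s] i]
      by (auto intro!: cube_boundary_update_other)
  qed
  then show "p (?\<Phi> (u, s)) = x0" using spheroidsD(3)[OF p] by blast
qed (use q r in auto)

section \<open>Homotopy groups\<close>

text \<open>
  Multiplication in a coordinate other than \<open>0\<close> is needed for the commutativity of higher homotopy
  groups.
\<close>

definition juxtapose ::
    "nat \<Rightarrow> nat \<Rightarrow> ((nat \<Rightarrow> real) \<Rightarrow> 'a) \<Rightarrow> ((nat \<Rightarrow> real) \<Rightarrow> 'a) \<Rightarrow> (nat \<Rightarrow> real) \<Rightarrow> 'a" where
  "juxtapose n i p q =
     (\<lambda>s\<in>topspace (cube n).
        if s i \<le> 1/2 then p (s(i := 2 * s i)) else q (s(i := 2 * s i - 1)))"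

lemma spheroid_mult_eq_juxtapose: "spheroid_mult n = juxtapose n 0"
  by (simp add: spheroid_mult_def juxtapose_def fun_eq_iff)

lemma juxtapose_homotopic:
  assumes i: "i < n" and p: "spheroid_homotopic n X x0 p p'" and q: "spheroid_homotopic n X x0 q q'"
  shows "spheroid_homotopic n X x0 (juxtapose n i p q) (juxtapose n i p' q')"
proof -
  obtain F where F: "continuous_map (prod_topology unit_interval (cube n)) X F"
    "\<And>s. s \<in> topspace (cube n) \<Longrightarrow> F (0, s) = p s"
    "\<And>s. s \<in> topspace (cube n) \<Longrightarrow> F (1, s) = p' s"
    "\<And>u s. 0 \<le> u \<Longrightarrow> u \<le> 1 \<Longrightarrow> s \<in> cube_boundary n \<Longrightarrow> F (u, s) = x0"
    using spheroid_homotopicE[OF p] by blast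
  obtain G where G: "continuous_map (prod_topology unit_interval (cube n)) X G"
    "\<And>s. s \<in> topspace (cube n) \<Longrightarrow> G (0, s) = q s"
    "\<And>s. s \<in> topspace (cube n) \<Longrightarrow> G (1, s) = q' s"
    "\<And>u s. 0 \<le> u \<Longrightarrow> u \<le> 1 \<Longrightarrow> s \<in> cube_boundary n \<Longrightarrow> G (u, s) = x0"
    using spheroid_homotopicE[OF q] by blast
  let ?D = "prod_topology unit_interval (cube n)"
  \<comment> \<open>The truncations make both halves defined on the whole cube.\<close>
  define lo where "lo z = (fst z, (snd z)(i := min 1 (2 * snd z i)))" for z :: "real \<times> (nat \<Rightarrow> real)"
  define hi where "hi z = (fst z, (snd z)(i := max 0 (2 * snd z i - 1)))" for z :: "real \<times> (nat \<Rightarrow> real)"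
  have s: "continuous_map ?D euclideanreal (\<lambda>z. snd z i)"
    by (rule continuous_map_coordinate[OF continuous_map_snd i])
  have lo: "continuous_map ?D ?D lo"
    unfolding lo_def
    by (intro continuous_map_pairedI continuous_map_fst continuous_map_cube_update continuous_map_snd i
          continuous_intros s) (use cube_coord[OF _ i] in auto)
  have hi: "continuous_map ?D ?D hi"
    unfolding hi_def
    by (intro continuous_map_pairedI continuous_map_fst continuous_map_cube_update continuous_map_snd i
          continuous_intros s) (use cube_coord[OF _ i] in auto)
  define H where "H z = (if snd z i \<le> 1/2 then F (lo z) else G (hi z))" for z
  have "continuous_map ?D X H"
    unfolding H_def
  proof (rule continuous_map_cases_le[OF s])
    show "continuous_map (subtopology ?D {x \<in> topspace ?D. snd x i \<le> 1/2}) X (\<lambda>z. F (lo z))"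
      using continuous_map_compose[OF lo F(1)] by (auto simp: o_def intro: continuous_map_from_subtopology)
    show "continuous_map (subtopology ?D {x \<in> topspace ?D. 1/2 \<le> snd x i}) X (\<lambda>z. G (hi z))"
      using continuous_map_compose[OF hi G(1)] by (auto simp: o_def intro: continuous_map_from_subtopology)
    fix z assume z: "z \<in> topspace ?D" "snd z i = 1/2"
    then have "F (lo z) = x0" "G (hi z) = x0"
      unfolding lo_def hi_def using i by (auto intro!: F G cube_boundary_update)
    then show "F (lo z) = G (hi z)" by simp
  qed simp
  then show ?thesis
  proof (rule spheroid_homotopicI)
    fix s assume s: "s \<in> topspace (cube n)"
    show "H (0, s) = juxtapose n i p q s" "H (1, s) = juxtapose n i p' q' s"
      using s i cube_coord[OF s i]
      by (auto simp: H_def lo_def hi_def juxtapose_def F(2,3) G(2,3) cube_update min_absorb2 max_absorb2)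
  next
    fix u :: real and s assume u: "0 \<le> u" "u \<le> 1" and s: "s \<in> cube_boundary n"
    have s': "s \<in> topspace (cube n)" using s by (rule cube_boundary_subset)
    have "s(i := min 1 (2 * s i)) \<in> cube_boundary n" if "s i \<le> 1/2"
      using cube_boundary_update[OF s' i] cube_boundary_update_other[OF s i] cube_coord[OF s' i] that
      by (cases "s i = 0") (auto simp: min_def)
    moreover have "s(i := max 0 (2 * s i - 1)) \<in> cube_boundary n" if "\<not> s i \<le> 1/2"
      using cube_boundary_update[OF s' i] cube_boundary_update_other[OF s i] cube_coord[OF s' i] that
      by (cases "s i = 1") (auto simp: max_def)
    ultimately show "H (u, s) = x0"
      using u F(4) G(4) by (simp add: H_def lo_def hi_def)
  qed
qed

lemma juxtapose_spheroids:
  assumes "i < n" "p \<in> spheroids n X x0" "q \<in> spheroids n X x0"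
  shows "juxtapose n i p q \<in> spheroids n X x0"
  using juxtapose_homotopic[OF assms(1) spheroidsD(4)[OF assms(2)] spheroidsD(4)[OF assms(3)]]
  unfolding spheroids_iff by (simp add: juxtapose_def)

definition const_spheroid :: "nat \<Rightarrow> 'a \<Rightarrow> (nat \<Rightarrow> real) \<Rightarrow> 'a" where
  "const_spheroid n x0 = (\<lambda>s\<in>topspace (cube n). x0)"

lemma const_spheroid_eq: "s \<in> topspace (cube n) \<Longrightarrow> const_spheroid n x s = x"
  by (simp add: const_spheroid_def)

lemma const_spheroid_mem: "x0 \<in> topspace X \<Longrightarrow> const_spheroid n x0 \<in> spheroids n X x0"
  unfolding const_spheroid_def by (rule spheroids_restrictI) auto

lemma juxtapose_const_right:
  assumes i: "i < n" and p: "p \<in> spheroids n X x0"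
  shows "spheroid_homotopic n X x0 (juxtapose n i p (const_spheroid n x0)) p"
proof (rule spheroid_reparametrize_coordinate[OF p i])
  show "continuous_on {0..1} (\<lambda>x::real. min 1 (2 * x))" by (intro continuous_intros)
  fix s assume s: "s \<in> topspace (cube n)"
  show "juxtapose n i p (const_spheroid n x0) s = p (s(i := min 1 (2 * s i)))"
    using s cube_coord[OF s i] i cube_boundary_update[OF s i, of 1]
    by (cases "s i \<le> 1/2")
      (auto simp: juxtapose_def const_spheroid_def cube_update spheroidsD(3)[OF p] min_absorb1 min_absorb2)
qed (auto intro: continuous_on_id)

lemma juxtapose_const_left:
  assumes i: "i < n" and p: "p \<in> spheroids n X x0"
  shows "spheroid_homotopic n X x0 (juxtapose n i (const_spheroid n x0) p) p"
proof (rule spheroid_reparametrize_coordinate[OF p i])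
  show "continuous_on {0..1} (\<lambda>x::real. max 0 (2 * x - 1))" by (intro continuous_intros)
  fix s assume s: "s \<in> topspace (cube n)"
  show "juxtapose n i (const_spheroid n x0) p s = p (s(i := max 0 (2 * s i - 1)))"
    using s cube_coord[OF s i] i cube_boundary_update[OF s i, of 0]
    by (cases "s i \<le> 1/2")
      (auto simp: juxtapose_def const_spheroid_def cube_update spheroidsD(3)[OF p] max_absorb1 max_absorb2)
qed (auto intro: continuous_on_id)

lemma juxtapose_assoc:
  assumes i: "i < n" and p: "p \<in> spheroids n X x0" and q: "q \<in> spheroids n X x0"
    and r: "r \<in> spheroids n X x0"
  shows "spheroid_homotopic n X x0
           (juxtapose n i (juxtapose n i p q) r) (juxtapose n i p (juxtapose n i q r))"
proof (rule spheroid_reparametrize_coordinate[of "juxtapose n i p (juxtapose n i q r)"])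
  \<comment> \<open>The concave piecewise linear map taking \<open>1/4, 1/2\<close> to \<open>1/2, 3/4\<close>.\<close>
  let ?\<phi> = "\<lambda>x::real. min (2 * x) (min (x + 1/4) ((x + 1) / 2))"
  show "continuous_on {0..1} ?\<phi>" by (intro continuous_intros) auto
  fix s assume s: "s \<in> topspace (cube n)"
  have "0 \<le> s i" "s i \<le> 1" using cube_coord[OF s i] by auto
  then consider "0 \<le> s i" "s i \<le> 1/4" | "1/4 < s i" "s i \<le> 1/2" | "1/2 < s i" "s i \<le> 1" by linarith
  then show "juxtapose n i (juxtapose n i p q) r s
      = juxtapose n i p (juxtapose n i q r) (s(i := ?\<phi> (s i)))"
  proof cases
    case 1
    then have "?\<phi> (s i) = 2 * s i" by (auto simp: min_def)
    with 1 s i show ?thesis by (simp add: juxtapose_def cube_update)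
  next
    case 2
    then have "?\<phi> (s i) = s i + 1/4" by (auto simp: min_def)
    with 2 s i show ?thesis by (simp add: juxtapose_def cube_update algebra_simps)
  next
    case 3
    then have "?\<phi> (s i) = (s i + 1) / 2" by (auto simp: min_def)
    then show ?thesis using 3 s i
      by (simp add: juxtapose_def cube_update add_divide_distrib)
  qed
next
  show "juxtapose n i p (juxtapose n i q r) \<in> spheroids n X x0"
    by (intro juxtapose_spheroids assms)
qed (use i in \<open>auto intro: continuous_on_id simp: min_def\<close>)

definition reverse_spheroid ::
    "nat \<Rightarrow> nat \<Rightarrow> ((nat \<Rightarrow> real) \<Rightarrow> 'a) \<Rightarrow> (nat \<Rightarrow> real) \<Rightarrow> 'a" where
  "reverse_spheroid n i p = (\<lambda>s\<in>topspace (cube n). p (s(i := 1 - s i)))"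

lemma reverse_spheroids:
  assumes i: "i < n" and p: "p \<in> spheroids n X x0"
  shows "reverse_spheroid n i p \<in> spheroids n X x0"
  unfolding reverse_spheroid_def
proof (rule spheroids_restrictI)
  have "continuous_map (cube n) (cube n) (\<lambda>s. s(i := 1 - s i))"
    by (intro continuous_map_cube_update continuous_intros continuous_map_coordinate i)
      (use cube_coord[OF _ i] i in auto)
  from continuous_map_compose[OF this spheroidsD(1)[OF p]]
  show "continuous_map (cube n) X (\<lambda>s. p (s(i := 1 - s i)))" by (simp add: o_def)
  fix s assume s: "s \<in> cube_boundary n"
  then have "s(i := 1 - s i) \<in> cube_boundary n"
    using cube_boundary_update[OF cube_boundary_subset[OF s] i, of "1 - s i"]
      cube_boundary_update_other[OF s i, of "1 - s i"] cube_coord[OF cube_boundary_subset[OF s] i]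
    by (cases "s i = 0 \<or> s i = 1") auto
  then show "p (s(i := 1 - s i)) = x0" by (rule spheroidsD(3)[OF p])
qed

text \<open>
  The juxtaposition is \<open>p\<close> precomposed with \<open>x \<mapsto> \<bar>2x - 1\<bar>\<close>, which has both ends at \<open>1\<close> and therefore
  contracts to the constant \<open>1\<close>.
\<close>

lemma juxtapose_reverse:
  assumes i: "i < n" and p: "p \<in> spheroids n X x0"
  shows "spheroid_homotopic n X x0 (juxtapose n i (reverse_spheroid n i p) p) (const_spheroid n x0)"
proof (rule spheroid_reparametrize_coordinate[OF p i])
  show "continuous_on {0..1} (\<lambda>x::real. \<bar>2 * x - 1\<bar>)" by (intro continuous_intros)
  fix s assume s: "s \<in> topspace (cube n)"
  show "juxtapose n i (reverse_spheroid n i p) p s = p (s(i := \<bar>2 * s i - 1\<bar>))"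
    using s cube_coord[OF s i] i
    by (auto simp: juxtapose_def reverse_spheroid_def cube_update)
  show "const_spheroid n x0 s = p (s(i := (\<lambda>_. 1) (s i)))"
    using s cube_boundary_update[OF s i, of 1] by (simp add: const_spheroid_def spheroidsD(3)[OF p])
qed auto

text \<open>
  The Eckmann--Hilton argument: juxtapositions in two different coordinates satisfy the interchange
  law strictly and have a common unit up to homotopy.
\<close>

lemma juxtapose_commute:
  assumes ij: "i < n" "j < n" "i \<noteq> j" and p: "p \<in> spheroids n X x0" and q: "q \<in> spheroids n X x0"
    and x0: "x0 \<in> topspace X"
  shows "spheroid_homotopic n X x0 (juxtapose n i p q) (juxtapose n i q p)"
proof -
  let ?c = "const_spheroid n x0"
  have interchange: "juxtapose n i (juxtapose n j a b) (juxtapose n j d e)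
      = juxtapose n j (juxtapose n i a d) (juxtapose n i b e)" for a b d e :: "(nat \<Rightarrow> real) \<Rightarrow> 'a"
  proof
    fix s
    show "juxtapose n i (juxtapose n j a b) (juxtapose n j d e) s
      = juxtapose n j (juxtapose n i a d) (juxtapose n i b e) s"
      using ij cube_coord[of s n i] cube_coord[of s n j]
      by (auto simp: juxtapose_def cube_update fun_upd_twist)
  qed
  note sym = homotopic_with_symD
  have "spheroid_homotopic n X x0 (juxtapose n i p q)
      (juxtapose n i (juxtapose n j p ?c) (juxtapose n j ?c q))"
    by (intro juxtapose_homotopic ij sym[OF juxtapose_const_right] sym[OF juxtapose_const_left] p q)
  then have 1: "spheroid_homotopic n X x0 (juxtapose n i p q)
      (juxtapose n j (juxtapose n i p ?c) (juxtapose n i ?c q))"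
    unfolding interchange .
  have 2: "spheroid_homotopic n X x0
      (juxtapose n j (juxtapose n i p ?c) (juxtapose n i ?c q))
      (juxtapose n j (juxtapose n i ?c p) (juxtapose n i q ?c))"
    by (rule juxtapose_homotopic[OF ij(2)
          homotopic_with_trans[OF juxtapose_const_right[OF ij(1) p] sym[OF juxtapose_const_left[OF ij(1) p]]]
          homotopic_with_trans[OF juxtapose_const_left[OF ij(1) q] sym[OF juxtapose_const_right[OF ij(1) q]]]])
  have "spheroid_homotopic n X x0
      (juxtapose n i (juxtapose n j ?c q) (juxtapose n j p ?c)) (juxtapose n i q p)"
    by (intro juxtapose_homotopic ij juxtapose_const_right juxtapose_const_left p q)
  then have 3: "spheroid_homotopic n X x0
      (juxtapose n j (juxtapose n i ?c p) (juxtapose n i q ?c)) (juxtapose n i q p)"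
    unfolding interchange .
  show ?thesis
    using homotopic_with_trans[OF 1 homotopic_with_trans[OF 2 3]] .
qed

lemma carrier_homotopy_group:
  "carrier (homotopy_group n X x0) = spheroid_class n X x0 ` spheroids n X x0"
  by (simp add: homotopy_group_def)

lemma one_homotopy_group:
  "\<one>\<^bsub>homotopy_group n X x0\<^esub> = spheroid_class n X x0 (const_spheroid n x0)"
  by (simp add: homotopy_group_def const_spheroid_def)

lemma mult_homotopy_group:
  assumes n: "n \<ge> 1" and p: "p \<in> spheroids n X x0" and q: "q \<in> spheroids n X x0"
  shows "spheroid_class n X x0 p \<otimes>\<^bsub>homotopy_group n X x0\<^esub> spheroid_class n X x0 q =
           spheroid_class n X x0 (juxtapose n 0 p q)"
proof -
  have "spheroid_class n X x0 (juxtapose n 0 p' q') = spheroid_class n X x0 (juxtapose n 0 p q)"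
    if "p' \<in> spheroid_class n X x0 p" "q' \<in> spheroid_class n X x0 q" for p' q'
    by (rule spheroid_class_mono[OF juxtapose_homotopic[OF _
          homotopic_with_symD[OF spheroid_class_memD(2)[OF that(1)]]
          homotopic_with_symD[OF spheroid_class_memD(2)[OF that(2)]]]]) (use n in simp)
  moreover have "p \<in> spheroid_class n X x0 p" "q \<in> spheroid_class n X x0 q"
    using p q by (auto intro: spheroid_class_self)
  ultimately have "(\<Union>p'\<in>spheroid_class n X x0 p. \<Union>q'\<in>spheroid_class n X x0 q.
      spheroid_class n X x0 (juxtapose n 0 p' q')) = spheroid_class n X x0 (juxtapose n 0 p q)"
    by blast
  then show ?thesis
    by (simp add: homotopy_group_def spheroid_mult_eq_juxtapose)
qed

lemma group_homotopy_group:
  assumes n: "n \<ge> 1" and x0: "x0 \<in> topspace X"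
  shows "group (homotopy_group n X x0)"
proof (rule groupI)
  let ?G = "homotopy_group n X x0" and ?S = "spheroids n X x0" and ?cl = "spheroid_class n X x0"
  have n0: "0 < n" using n by simp
  note [simp] = carrier_homotopy_group one_homotopy_group mult_homotopy_group[OF n]
    juxtapose_spheroids[OF n0] const_spheroid_mem[OF x0]
  show "\<one>\<^bsub>?G\<^esub> \<in> carrier ?G" by simp
  fix x assume "x \<in> carrier ?G"
  then obtain p where p: "p \<in> ?S" "x = ?cl p" by auto
  show "\<one>\<^bsub>?G\<^esub> \<otimes>\<^bsub>?G\<^esub> x = x"
    using p spheroid_class_mono[OF juxtapose_const_left[OF n0 p(1)]] by simp
  show "\<exists>y\<in>carrier ?G. y \<otimes>\<^bsub>?G\<^esub> x = \<one>\<^bsub>?G\<^esub>"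
    using p spheroid_class_mono[OF juxtapose_reverse[OF n0 p(1)]] reverse_spheroids[OF n0 p(1)]
    by (intro bexI[of _ "?cl (reverse_spheroid n 0 p)"]) auto
  fix y assume "y \<in> carrier ?G"
  then obtain q where q: "q \<in> ?S" "y = ?cl q" by auto
  show "x \<otimes>\<^bsub>?G\<^esub> y \<in> carrier ?G" using p q by simp
  fix z assume "z \<in> carrier ?G"
  then obtain r where r: "r \<in> ?S" "z = ?cl r" by auto
  show "(x \<otimes>\<^bsub>?G\<^esub> y) \<otimes>\<^bsub>?G\<^esub> z = x \<otimes>\<^bsub>?G\<^esub> (y \<otimes>\<^bsub>?G\<^esub> z)"
    using p q r spheroid_class_mono[OF juxtapose_assoc[OF n0 p(1) q(1) r(1)]] by simp
qed

lemma comm_group_homotopy_group: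
  assumes n: "n \<ge> 2" and x0: "x0 \<in> topspace X"
  shows "comm_group (homotopy_group n X x0)"
proof (rule group.group_comm_groupI)
  have n1: "n \<ge> 1" using n by simp
  show "group (homotopy_group n X x0)" by (rule group_homotopy_group[OF n1 x0])
  fix x y assume "x \<in> carrier (homotopy_group n X x0)" "y \<in> carrier (homotopy_group n X x0)"
  then obtain p q where p: "p \<in> spheroids n X x0" "x = spheroid_class n X x0 p"
    and q: "q \<in> spheroids n X x0" "y = spheroid_class n X x0 q"
    by (auto simp: carrier_homotopy_group)
  show "x \<otimes>\<^bsub>homotopy_group n X x0\<^esub> y = y \<otimes>\<^bsub>homotopy_group n X x0\<^esub> x"
    unfolding p(2) q(2) mult_homotopy_group[OF n1 p(1) q(1)] mult_homotopy_group[OF n1 q(1) p(1)]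
    by (rule spheroid_class_mono, rule juxtapose_commute[of 0 n 1]) (use n p q x0 in auto)
qed

section \<open>Evaluation subgroups\<close>

lemma compose_homotopic:
  assumes k: "continuous_map X Y k" "k x0 = y0" and pq: "spheroid_homotopic n X x0 p q"
  shows "spheroid_homotopic n Y y0 (restrict (k \<circ> p) (topspace (cube n)))
           (restrict (k \<circ> q) (topspace (cube n)))"
proof -
  obtain H where H: "continuous_map (prod_topology unit_interval (cube n)) X H"
    "\<And>s. s \<in> topspace (cube n) \<Longrightarrow> H (0, s) = p s"
    "\<And>s. s \<in> topspace (cube n) \<Longrightarrow> H (1, s) = q s"
    "\<And>u s. 0 \<le> u \<Longrightarrow> u \<le> 1 \<Longrightarrow> s \<in> cube_boundary n \<Longrightarrow> H (u, s) = x0"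
    using spheroid_homotopicE[OF pq] by blast
  show ?thesis
    by (rule spheroid_homotopicI[where H = "k \<circ> H"])
      (use H k continuous_map_compose[OF H(1) k(1)] in auto)
qed

lemma compose_spheroids:
  assumes k: "continuous_map X Y k" "k x0 = y0" and p: "p \<in> spheroids n X x0"
  shows "restrict (k \<circ> p) (topspace (cube n)) \<in> spheroids n Y y0"
  using compose_homotopic[OF k spheroidsD(4)[OF p]] by (simp add: spheroids_iff)

lemma homotopy_group_map_class:
  assumes k: "continuous_map X Y k" "k x0 = y0" and p: "p \<in> spheroids n X x0"
  shows "homotopy_group_map n Y y0 k (spheroid_class n X x0 p) =
           spheroid_class n Y y0 (restrict (k \<circ> p) (topspace (cube n)))"
proof -
  have "spheroid_class n Y y0 (restrict (k \<circ> q) (topspace (cube n))) =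
      spheroid_class n Y y0 (restrict (k \<circ> p) (topspace (cube n)))"
    if "q \<in> spheroid_class n X x0 p" for q
    by (rule spheroid_class_mono[OF compose_homotopic[OF k
          homotopic_with_symD[OF spheroid_class_memD(2)[OF that]]]])
  then show ?thesis
    unfolding homotopy_group_map_def using spheroid_class_self[OF p] by blast
qed

lemma homotopy_group_map_hom:
  assumes k: "continuous_map X Y k" "k x0 = y0" and n: "n \<ge> 1"
  shows "homotopy_group_map n Y y0 k \<in> hom (homotopy_group n X x0) (homotopy_group n Y y0)"
proof (rule homI)
  have n0: "0 < n" using n by simp
  fix x assume "x \<in> carrier (homotopy_group n X x0)"
  then obtain p where p: "p \<in> spheroids n X x0" "x = spheroid_class n X x0 p"
    by (auto simp: carrier_homotopy_group)
  show "homotopy_group_map n Y y0 k x \<in> carrier (homotopy_group n Y y0)"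
    using p compose_spheroids[OF k] by (simp add: homotopy_group_map_class[OF k] carrier_homotopy_group)
  fix y assume "y \<in> carrier (homotopy_group n X x0)"
  then obtain q where q: "q \<in> spheroids n X x0" "y = spheroid_class n X x0 q"
    by (auto simp: carrier_homotopy_group)
  have "restrict (k \<circ> juxtapose n 0 p q) (topspace (cube n)) =
      juxtapose n 0 (restrict (k \<circ> p) (topspace (cube n))) (restrict (k \<circ> q) (topspace (cube n)))"
  proof
    fix s
    show "restrict (k \<circ> juxtapose n 0 p q) (topspace (cube n)) s =
      juxtapose n 0 (restrict (k \<circ> p) (topspace (cube n))) (restrict (k \<circ> q) (topspace (cube n))) s"
      using n0 cube_coord[of s n 0] by (auto simp: juxtapose_def cube_update)
  qed
  then show "homotopy_group_map n Y y0 k (x \<otimes>\<^bsub>homotopy_group n X x0\<^esub> y) =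
      homotopy_group_map n Y y0 k x \<otimes>\<^bsub>homotopy_group n Y y0\<^esub> homotopy_group_map n Y y0 k y"
    using p q compose_spheroids[OF k]
    by (simp add: mult_homotopy_group[OF n] homotopy_group_map_class[OF k] juxtapose_spheroids[OF n0])
qed

lemma path_connected_space_cube: "path_connected_space (cube n)"
proof -
  have "path_connected_space unit_interval"
    using path_connectedin_iff_path_connected_real[of "{0..1}"]
    by (simp add: path_connectedin_def convex_imp_path_connected)
  then show ?thesis
    by (simp add: cube_def path_connected_space_product_topology)
qed

text \<open>
  This turns maps from a cube into a full mapping space into maps to one of its path components:
  only a single value has to be located.
\<close>

lemma path_component_cube:
  assumes h: "continuous_map (cube n) T h" and s: "s \<in> topspace (cube n)" "s' \<in> topspace (cube n)"
    and c: "h s \<in> path_component_of_set T c"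
  shows "h s' \<in> path_component_of_set T c"
proof -
  have "path_connectedin T (h ` topspace (cube n))"
    using path_connectedin_continuous_map_image[OF h] path_connected_space_cube[of n]
    by (simp add: path_connectedin_topspace)
  then have "path_component_of T (h s) (h s')"
    using s unfolding path_connectedin path_component_of_def by blast
  then show ?thesis using c path_component_of_trans by fastforce
qed

lemma cube_boundary_nonempty:
  assumes "n \<ge> 1" shows "(\<lambda>i\<in>{..<n}. 0) \<in> cube_boundary n"
  using assms by (auto simp: cube_boundary_def topspace_cube intro!: exI[of _ 0])

lemma restrict_mem_map_component:
  assumes "continuous_map U V g"
  shows "restrict g (topspace U) \<in> topspace (map_component U V g)"
proof -
  have "continuous_map U V (restrict g (topspace U))"
    using assms by (rule continuous_map_eq) simp
  then have "restrict g (topspace U) \<in> topspace (compact_open_topology U V)"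
    by (simp add: topspace_compact_open_topology)
  then show ?thesis by (simp add: map_component_def path_component_of_refl)
qed

lemma continuous_map_map_component_eval_point:
  "u \<in> topspace U \<Longrightarrow> continuous_map (map_component U V g) V (\<lambda>h. h u)"
  unfolding map_component_def
  by (intro continuous_map_from_subtopology continuous_map_compact_open_eval_point)

text \<open>
  Currying is continuous for every \<open>U\<close>, so elements of the evaluation subgroup may be given by maps
  on \<open>I\<^sup>n \<times> U\<close>.  The converse description, in \<open>evaluation_subgroupE\<close>, stays in curried form, since
  uncurrying requires compact neighbourhoods in \<open>U\<close>.
\<close>

lemma evaluation_subgroupI:
  assumes n: "n \<ge> 1" and F: "continuous_map (prod_topology (cube n) U) V F"
    and bd: "\<And>s u. s \<in> cube_boundary n \<Longrightarrow> u \<in> topspace U \<Longrightarrow> F (s, u) = g u"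
    and u0: "u0 \<in> topspace U"
  shows "spheroid_class n V (g u0) (\<lambda>s\<in>topspace (cube n). F (s, u0))
           \<in> carrier (evaluation_subgroup n V U g u0)"
proof -
  let ?g = "restrict g (topspace U)"
  let ?T = "compact_open_topology U V"
  define P where "P = (\<lambda>s\<in>topspace (cube n). \<lambda>u\<in>topspace U. F (s, u))"
  have P: "continuous_map (cube n) ?T P"
    using continuous_map_curry[OF F] by (rule continuous_map_eq) (simp add: P_def)
  have Pbd: "P s = ?g" if "s \<in> cube_boundary n" for s
    using bd[OF that] cube_boundary_subset[OF that] by (auto simp: P_def fun_eq_iff)
  let ?b = "\<lambda>i\<in>{..<n}. 0::real"
  have b: "?b \<in> cube_boundary n" by (rule cube_boundary_nonempty[OF n])
  have bt: "?b \<in> topspace (cube n)" by (rule cube_boundary_subset[OF b])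
  have "?g \<in> topspace ?T"
    using continuous_map_image_subset_topspace[OF P] bt Pbd[OF b] by (metis image_subset_iff)
  then have g: "P ?b \<in> path_component_of_set ?T ?g"
    using Pbd[OF b] by (simp add: path_component_of_refl)
  have "P s \<in> path_component_of_set ?T ?g" if "s \<in> topspace (cube n)" for s
    by (rule path_component_cube[OF P bt that g])
  then have "continuous_map (cube n) (map_component U V g) P"
    unfolding map_component_def using P by (auto simp: continuous_map_in_subtopology)
  then have P': "P \<in> spheroids n (map_component U V g) ?g"
    using Pbd by (auto simp: spheroids_def P_def)
  have "homotopy_group_map n V (g u0) (\<lambda>h. h u0) (spheroid_class n (map_component U V g) ?g P)
      = spheroid_class n V (g u0) (restrict ((\<lambda>h. h u0) \<circ> P) (topspace (cube n)))"
    by (rule homotopy_group_map_class[OF continuous_map_map_component_eval_point[OF u0] _ P'])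
      (use u0 in simp)
  also have "restrict ((\<lambda>h. h u0) \<circ> P) (topspace (cube n)) = (\<lambda>s\<in>topspace (cube n). F (s, u0))"
    by (rule restrict_ext) (simp add: P_def u0)
  finally have eq: "homotopy_group_map n V (g u0) (\<lambda>h. h u0) (spheroid_class n (map_component U V g) ?g P)
      = spheroid_class n V (g u0) (\<lambda>s\<in>topspace (cube n). F (s, u0))" .
  have "spheroid_class n (map_component U V g) ?g P \<in> carrier (homotopy_group n (map_component U V g) ?g)"
    using P' by (simp add: carrier_homotopy_group)
  then have "homotopy_group_map n V (g u0) (\<lambda>h. h u0) (spheroid_class n (map_component U V g) ?g P)
      \<in> carrier (evaluation_subgroup n V U g u0)"
    by (simp add: evaluation_subgroup_def)
  then show ?thesis unfolding eq .
qed

lemma evaluation_subgroupE: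
  assumes A: "A \<in> carrier (evaluation_subgroup n V U g u0)" and u0: "u0 \<in> topspace U"
  obtains P where "continuous_map (cube n) (compact_open_topology U V) P"
    "\<And>s. s \<in> cube_boundary n \<Longrightarrow> P s = restrict g (topspace U)"
    "(\<lambda>s\<in>topspace (cube n). P s u0) \<in> spheroids n V (g u0)"
    "A = spheroid_class n V (g u0) (\<lambda>s\<in>topspace (cube n). P s u0)"
proof -
  let ?g = "restrict g (topspace U)"
  obtain P where P: "P \<in> spheroids n (map_component U V g) ?g"
    and A': "A = homotopy_group_map n V (g u0) (\<lambda>h. h u0) (spheroid_class n (map_component U V g) ?g P)"
    using A by (auto simp: evaluation_subgroup_def carrier_homotopy_group)
  have ev: "continuous_map (map_component U V g) V (\<lambda>h. h u0)" "(\<lambda>h. h u0) ?g = g u0"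
    using u0 continuous_map_map_component_eval_point by auto
  have eq: "restrict ((\<lambda>h. h u0) \<circ> P) (topspace (cube n)) = (\<lambda>s\<in>topspace (cube n). P s u0)"
    by (simp add: o_def)
  show ?thesis
  proof (rule that)
    show "continuous_map (cube n) (compact_open_topology U V) P"
      using spheroidsD(1)[OF P] unfolding map_component_def by (rule continuous_map_into_fulltopology)
    show "P s = ?g" if "s \<in> cube_boundary n" for s by (rule spheroidsD(3)[OF P that])
    show "(\<lambda>s\<in>topspace (cube n). P s u0) \<in> spheroids n V (g u0)"
      using compose_spheroids[OF ev P] unfolding eq .
    show "A = spheroid_class n V (g u0) (\<lambda>s\<in>topspace (cube n). P s u0)"
      using A' homotopy_group_map_class[OF ev P] unfolding eq by simp
  qed
qed

lemma evaluation_spheroid: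
  assumes F: "continuous_map (prod_topology (cube n) U) V F"
    and "\<And>s. s \<in> cube_boundary n \<Longrightarrow> F (s, u) = v" and u: "u \<in> topspace U"
  shows "(\<lambda>s\<in>topspace (cube n). F (s, u)) \<in> spheroids n V v"
proof (rule spheroids_restrictI)
  have "continuous_map (cube n) (prod_topology (cube n) U) (\<lambda>s. (s, u))"
    using u by (intro continuous_map_pairedI) auto
  from continuous_map_compose[OF this F] show "continuous_map (cube n) V (\<lambda>s. F (s, u))"
    by (simp add: o_def)
qed fact

lemma evaluation_subgroup_eq:
  "evaluation_subgroup n V U g u0 =
     (homotopy_group n V (g u0))\<lparr>carrier := carrier (evaluation_subgroup n V U g u0)\<rparr>"
  by (simp add: evaluation_subgroup_def)

lemma subgroup_evaluation_subgroup:
  assumes n: "n \<ge> 1" and g: "continuous_map U V g" and u0: "u0 \<in> topspace U"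
  shows "subgroup (carrier (evaluation_subgroup n V U g u0)) (homotopy_group n V (g u0))"
proof -
  let ?g = "restrict g (topspace U)" and ?k = "homotopy_group_map n V (g u0) (\<lambda>h. h u0)"
  have "?k \<in> hom (homotopy_group n (map_component U V g) ?g) (homotopy_group n V (g u0))"
    by (rule homotopy_group_map_hom[OF continuous_map_map_component_eval_point[OF u0] _ n])
      (use u0 in simp)
  moreover have "group (homotopy_group n (map_component U V g) ?g)"
    by (rule group_homotopy_group[OF n restrict_mem_map_component[OF g]])
  moreover have "g u0 \<in> topspace V"
    using continuous_map_image_subset_topspace[OF g] u0 by blast
  then have "group (homotopy_group n V (g u0))"
    by (rule group_homotopy_group[OF n])
  ultimately have "group_hom (homotopy_group n (map_component U V g) ?g) (homotopy_group n V (g u0)) ?k"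
    by (simp add: group_hom_def group_hom_axioms_def)
  from group_hom.img_is_subgroup[OF this] show ?thesis
    by (simp add: evaluation_subgroup_def)
qed

lemma comm_group_evaluation_subgroup:
  assumes n: "n \<ge> 2" and g: "continuous_map U V g" and u0: "u0 \<in> topspace U"
  shows "comm_group (evaluation_subgroup n V U g u0)"
proof -
  have "g u0 \<in> topspace V"
    using continuous_map_image_subset_topspace[OF g] u0 by blast
  then interpret G: comm_group "homotopy_group n V (g u0)"
    by (rule comm_group_homotopy_group[OF n])
  have S: "subgroup (carrier (evaluation_subgroup n V U g u0)) (homotopy_group n V (g u0))"
    using n by (intro subgroup_evaluation_subgroup g u0) simp
  have "group (evaluation_subgroup n V U g u0)"
    by (subst evaluation_subgroup_eq) (rule subgroup.subgroup_is_group[OF S G.group_axioms])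
  then show ?thesis
  proof (rule group.group_comm_groupI)
    fix x y assume "x \<in> carrier (evaluation_subgroup n V U g u0)"
      "y \<in> carrier (evaluation_subgroup n V U g u0)"
    then have "x \<otimes>\<^bsub>homotopy_group n V (g u0)\<^esub> y = y \<otimes>\<^bsub>homotopy_group n V (g u0)\<^esub> x"
      using subgroup.subset[OF S] by (intro G.m_comm) auto
    then show "x \<otimes>\<^bsub>evaluation_subgroup n V U g u0\<^esub> y = y \<otimes>\<^bsub>evaluation_subgroup n V U g u0\<^esub> x"
      by (simp add: evaluation_subgroup_def)
  qed
qed

section \<open>Spheroids of loops\<close>

lemma const_loop_eq: "w \<in> sphere 0 1 \<Longrightarrow> const_loop y w = y"
  by (simp add: const_loop_def)

lemma const_loop_mem: "y \<in> topspace Y \<Longrightarrow> const_loop y \<in> topspace (compact_open_topology circle Y)"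
proof -
  assume y: "y \<in> topspace Y"
  have "continuous_map circle Y (\<lambda>w\<in>topspace circle. y)"
    by (rule continuous_map_eq[of _ _ "\<lambda>_. y"]) (use y in auto)
  then show ?thesis by (simp add: const_loop_def topspace_compact_open_topology)
qed

lemma free_loop_space_eq:
  "free_loop_space Y y0 = subtopology (compact_open_topology circle Y)
     (path_component_of_set (compact_open_topology circle Y) (const_loop y0))"
  by (simp add: free_loop_space_def map_component_def const_loop_def)

lemma const_loop_component:
  "y \<in> topspace Y \<Longrightarrow>
     const_loop y \<in> path_component_of_set (compact_open_topology circle Y) (const_loop y)"
  using const_loop_mem[of y Y] by (simp add: path_component_of_refl)

lemma continuous_map_from_free_loop_space:
  "continuous_map (free_loop_space Y y0) (compact_open_topology circle Y) (\<lambda>\<gamma>. \<gamma>)"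
  unfolding free_loop_space_eq by (intro continuous_map_from_subtopology) simp

lemma continuous_map_free_loop_space_full:
  "continuous_map Z (free_loop_space Y y0) \<beta> \<Longrightarrow> continuous_map Z (compact_open_topology circle Y) \<beta>"
  unfolding free_loop_space_eq by (rule continuous_map_into_fulltopology)

lemma cube_extend:
  "s \<in> topspace (cube n) \<Longrightarrow> 0 \<le> t \<Longrightarrow> t \<le> 1 \<Longrightarrow> s(n := t) \<in> topspace (cube (Suc n))"
  by (auto simp: topspace_cube PiE_iff extensional_def less_Suc_eq)

lemma cube_extend_boundary:
  "s \<in> cube_boundary n \<Longrightarrow> 0 \<le> t \<Longrightarrow> t \<le> 1 \<Longrightarrow> s(n := t) \<in> cube_boundary (Suc n)"
  using cube_extend[of s n t] by (auto simp: cube_boundary_def less_Suc_eq)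

lemma cube_extend_ends:
  "s \<in> topspace (cube n) \<Longrightarrow> t = 0 \<or> t = 1 \<Longrightarrow> s(n := t) \<in> cube_boundary (Suc n)"
  using cube_extend[of s n t] by (auto simp: cube_boundary_def)

lemma cube_truncate:
  "s \<in> topspace (cube (Suc n)) \<Longrightarrow> restrict s {..<n} \<in> topspace (cube n)"
  by (auto simp: topspace_cube PiE_iff)

lemma continuous_map_cube_extend:
  assumes \<sigma>: "continuous_map Z (cube n) \<sigma>" and \<phi>: "continuous_map Z euclideanreal \<phi>"
    and "\<And>z. z \<in> topspace Z \<Longrightarrow> 0 \<le> \<phi> z \<and> \<phi> z \<le> 1"
  shows "continuous_map Z (cube (Suc n)) (\<lambda>z. (\<sigma> z)(n := \<phi> z))"
proof -
  have \<phi>': "continuous_map Z unit_interval \<phi>"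
    by (rule continuous_map_into_unit_interval) (use assms in auto)
  have "continuous_map Z unit_interval (\<lambda>z. \<sigma> z j)" if "j < n" for j
    using \<sigma> that unfolding cube_def by (auto simp: continuous_map_componentwise)
  then have 1: "continuous_map Z unit_interval (\<lambda>z. ((\<sigma> z)(n := \<phi> z)) j)" if "j < Suc n" for j
    using that \<phi>' by (cases "j = n") auto
  have 2: "(\<sigma> z)(n := \<phi> z) \<in> extensional {..<Suc n}" if "z \<in> topspace Z" for z
    using \<sigma> that unfolding cube_def
    by (auto simp: continuous_map_componentwise extensional_def image_subset_iff)
  show ?thesis
    unfolding cube_def continuous_map_componentwise using 1 2 by blast
qed

lemma continuous_map_cube_truncate:
  assumes \<sigma>: "continuous_map Z (cube (Suc n)) \<sigma>"
  shows "continuous_map Z (cube n) (\<lambda>z. restrict (\<sigma> z) {..<n})"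
  using assms unfolding cube_def by (auto simp: continuous_map_componentwise)

text \<open>
  Let \<open>\<beta>\<close> be a family of free loops on \<open>I\<^sup>n\<close> that is constant at \<open>y\<close> on the boundary, and let
  \<open>a s = \<beta> s 1\<close> be its base points.  In coordinate \<open>1\<close>, \<open>unloop n \<beta>\<close> is first \<open>\<beta>\<close> and then the reversed
  family of constant loops at \<open>a\<close>; thus coordinate \<open>1\<close> runs from \<open>0\<close> to \<open>1\<close> and back, which is the
  term \<open>min (2 x) (2 - 2 x)\<close> in \<open>squeeze\<close>.  The last coordinate is the loop parameter.  The loops are
  traversed while it crosses its middle third (\<open>middle\<close>).  In the outer thirds the loops rest at
  their base points, and there \<open>plateau\<close> cuts the path of base points \<open>a\<close> off ever earlier, until it
  is constant at \<open>y\<close> on the outer faces.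
\<close>

definition plateau :: "real \<Rightarrow> real" where
  "plateau t = min 1 (min (3 * t) (3 - 3 * t))"

definition middle :: "real \<Rightarrow> real" where
  "middle t = max 0 (min 1 (3 * t - 1))"

definition squeeze :: "nat \<Rightarrow> (nat \<Rightarrow> real) \<Rightarrow> nat \<Rightarrow> real" where
  "squeeze n s = restrict (s(1 := min (min (2 * s 1) (2 - 2 * s 1)) (plateau (s n)))) {..<n}"

definition unloop :: "nat \<Rightarrow> ((nat \<Rightarrow> real) \<Rightarrow> complex \<Rightarrow> 'a) \<Rightarrow> (nat \<Rightarrow> real) \<Rightarrow> 'a" where
  "unloop n \<beta> = (\<lambda>s\<in>topspace (cube (Suc n)).
     \<beta> (squeeze n s) (if s 1 \<le> 1/2 then circle_exp (middle (s n)) else 1))"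

lemma plateau_bounds: "0 \<le> t \<Longrightarrow> t \<le> 1 \<Longrightarrow> 0 \<le> plateau t \<and> plateau t \<le> 1"
  by (auto simp: plateau_def)

lemma middle_bounds: "0 \<le> middle t \<and> middle t \<le> 1"
  by (auto simp: middle_def)

lemma middle_end: "plateau t \<noteq> 1 \<Longrightarrow> middle t = 0 \<or> middle t = 1"
  by (auto simp: plateau_def middle_def min_def max_def split: if_splits)

lemma plateau_ends [simp]: "plateau 0 = 0" "plateau 1 = 0"
  and middle_ends [simp]: "middle 0 = 0" "middle 1 = 1"
  by (auto simp: plateau_def middle_def)

lemma squeeze_coord_bounds:
  assumes s: "s \<in> topspace (cube (Suc n))" and n: "n \<ge> 2"
  shows "0 \<le> min (min (2 * s 1) (2 - 2 * s 1)) (plateau (s n)) \<and>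
         min (min (2 * s 1) (2 - 2 * s 1)) (plateau (s n)) \<le> 1"
  using cube_coord[OF s, of 1] cube_coord[OF s, of n] n plateau_bounds[of "s n"]
  by (auto simp: min_def)

lemma squeeze_mem:
  assumes s: "s \<in> topspace (cube (Suc n))" and n: "n \<ge> 2"
  shows "squeeze n s \<in> topspace (cube n)"
  unfolding squeeze_def
  by (rule cube_truncate, rule cube_update[OF s]) (use squeeze_coord_bounds[OF s n] n in auto)

lemma squeeze_coord:
    "n \<ge> 2 \<Longrightarrow> squeeze n s (Suc 0) = min (min (2 * s (Suc 0)) (2 - 2 * s (Suc 0))) (plateau (s n))"
  and squeeze_coord_other: "i < n \<Longrightarrow> i \<noteq> 1 \<Longrightarrow> squeeze n s i = s i"
  by (auto simp: squeeze_def)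

text \<open>
  The form of the conclusion shows that the image of the boundary stays in the boundary when
  coordinate \<open>1\<close> is scaled down; \<open>unloop_const_loops\<close> contracts that coordinate.
\<close>

lemma squeeze_boundary_cases:
  assumes s: "s \<in> cube_boundary (Suc n)" and n: "n \<ge> 2"
  shows "squeeze n s 1 = 0 \<or> (\<exists>i<n. i \<noteq> 1 \<and> (squeeze n s i = 0 \<or> squeeze n s i = 1))"
proof -
  have s': "s \<in> topspace (cube (Suc n))" using s by (rule cube_boundary_subset)
  obtain i where i: "i < Suc n" "s i = 0 \<or> s i = 1" using s by (auto simp: cube_boundary_def)
  consider "i = 1" | "i = n" | "i < n" "i \<noteq> 1" using i by linarith
  then show ?thesis
  proof cases
    case 1
    then have "squeeze n s 1 = 0"
      using i n plateau_bounds[of "s n"] cube_coord[OF s', of n] by (auto simp: squeeze_coord)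
    then show ?thesis ..
  next
    case 2
    then have "squeeze n s 1 = 0"
      using i n cube_coord[OF s', of 1] by (auto simp: squeeze_coord)
    then show ?thesis ..
  next
    case 3
    then show ?thesis using i squeeze_coord_other[of i n s] by auto
  qed
qed

lemma squeeze_boundary:
  assumes s: "s \<in> cube_boundary (Suc n)" and n: "n \<ge> 2"
  shows "squeeze n s \<in> cube_boundary n"
proof -
  have "1 < n" using n by simp
  then have "\<exists>i<n. squeeze n s i = 0 \<or> squeeze n s i = 1"
    using squeeze_boundary_cases[OF assms] by blast
  then show ?thesis
    using squeeze_mem[OF cube_boundary_subset[OF s] n] by (simp add: cube_boundary_def)
qed

lemma continuous_map_plateau:
  "continuous_map Z euclideanreal \<phi> \<Longrightarrow> continuous_map Z euclideanreal (\<lambda>z. plateau (\<phi> z))"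
  unfolding plateau_def by (intro continuous_intros) auto

lemma continuous_map_middle:
  "continuous_map Z euclideanreal \<phi> \<Longrightarrow> continuous_map Z euclideanreal (\<lambda>z. middle (\<phi> z))"
  unfolding middle_def by (intro continuous_intros) auto

lemma continuous_map_squeeze:
  assumes \<sigma>: "continuous_map Z (cube (Suc n)) \<sigma>" and n: "n \<ge> 2"
  shows "continuous_map Z (cube n) (\<lambda>z. squeeze n (\<sigma> z))"
proof -
  have s1: "continuous_map Z euclideanreal (\<lambda>z. \<sigma> z 1)"
    and sn: "continuous_map Z euclideanreal (\<lambda>z. \<sigma> z n)"
    using n by (auto intro: continuous_map_coordinate[OF \<sigma>])
  have mem: "\<sigma> z \<in> topspace (cube (Suc n))" if "z \<in> topspace Z" for z
    using continuous_map_image_subset_topspace[OF \<sigma>] that by blast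
  show ?thesis
    unfolding squeeze_def
  proof (intro continuous_map_cube_truncate continuous_map_cube_update \<sigma>)
    show "continuous_map Z euclideanreal
        (\<lambda>z. min (min (2 * \<sigma> z 1) (2 - 2 * \<sigma> z 1)) (plateau (\<sigma> z n)))"
      by (intro continuous_intros continuous_map_plateau s1 sn) auto
  qed (use squeeze_coord_bounds[OF mem n] n in auto)
qed

text \<open>
  The parameter space \<open>Z\<close> is the interval for homotopies of spheroids of loops, and \<open>X\<close> for families of
  spheroids over \<open>X\<close>.  The two branches agree where \<open>s 1 = 1/2\<close>: either the last coordinate lies in an outer third,
  where the loop has not started or is finished, or \<open>squeeze\<close> has reached the face of the cube on
  which all loops are constant.
\<close>

lemma continuous_map_unloop:
  assumes n: "n \<ge> 2" and \<beta>: "continuous_map (prod_topology Z (cube n)) (compact_open_topology circle Y) \<beta>"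
    and bd: "\<And>z s. z \<in> topspace Z \<Longrightarrow> s \<in> cube_boundary n \<Longrightarrow> \<beta> (z, s) = const_loop (g z)"
    and \<zeta>: "continuous_map S Z \<zeta>" and \<sigma>: "continuous_map S (cube (Suc n)) \<sigma>"
  shows "continuous_map S Y (\<lambda>d. unloop n (\<lambda>s. \<beta> (\<zeta> d, s)) (\<sigma> d))"
proof -
  have s1: "continuous_map S euclideanreal (\<lambda>d. \<sigma> d 1)"
    and sn: "continuous_map S euclideanreal (\<lambda>d. \<sigma> d n)"
    using n by (auto intro: continuous_map_coordinate[OF \<sigma>])
  have mem: "\<sigma> d \<in> topspace (cube (Suc n))" "\<zeta> d \<in> topspace Z" if "d \<in> topspace S" for d
    using continuous_map_image_subset_topspace[OF \<sigma>] continuous_map_image_subset_topspace[OF \<zeta>] that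
    by blast+
  have pair: "continuous_map S (prod_topology Z (cube n)) (\<lambda>d. (\<zeta> d, squeeze n (\<sigma> d)))"
    by (intro continuous_map_pairedI \<zeta> continuous_map_squeeze \<sigma> n)
  have "continuous_map S unit_interval (\<lambda>d. middle (\<sigma> d n))"
    by (rule continuous_map_into_unit_interval[OF continuous_map_middle[OF sn]]) (rule middle_bounds)
  from continuous_map_compose[OF this continuous_map_circle_exp]
  have e: "continuous_map S circle (\<lambda>d. circle_exp (middle (\<sigma> d n)))" by (simp add: o_def)
  note uncurry = continuous_map_uncurry[OF neighbourhood_base_circle \<beta> pair]
  have "continuous_map S Y (\<lambda>d. if \<sigma> d 1 \<le> 1/2
      then \<beta> (\<zeta> d, squeeze n (\<sigma> d)) (circle_exp (middle (\<sigma> d n)))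
      else \<beta> (\<zeta> d, squeeze n (\<sigma> d)) 1)"
  proof (rule continuous_map_cases_le[OF s1])
    show "continuous_map (subtopology S {d \<in> topspace S. \<sigma> d 1 \<le> 1/2}) Y
        (\<lambda>d. \<beta> (\<zeta> d, squeeze n (\<sigma> d)) (circle_exp (middle (\<sigma> d n))))"
      by (rule continuous_map_from_subtopology[OF uncurry[OF e]])
    show "continuous_map (subtopology S {d \<in> topspace S. 1/2 \<le> \<sigma> d 1}) Y
        (\<lambda>d. \<beta> (\<zeta> d, squeeze n (\<sigma> d)) 1)"
      by (rule continuous_map_from_subtopology[OF uncurry]) simp
    fix d assume d: "d \<in> topspace S" and half: "\<sigma> d 1 = 1/2"
    show "\<beta> (\<zeta> d, squeeze n (\<sigma> d)) (circle_exp (middle (\<sigma> d n))) = \<beta> (\<zeta> d, squeeze n (\<sigma> d)) 1"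
    proof (cases "plateau (\<sigma> d n) = 1")
      case True
      then have "squeeze n (\<sigma> d) 1 = 1" using half n by (simp add: squeeze_coord)
      moreover have "1 < n" using n by simp
      ultimately have "squeeze n (\<sigma> d) \<in> cube_boundary n"
        using squeeze_mem[OF mem(1)[OF d] n] unfolding cube_boundary_def by blast
      then show ?thesis
        using bd mem(2)[OF d] circle_exp_mem by (simp add: const_loop_eq)
    next
      case False
      then show ?thesis using middle_end[OF False] by auto
    qed
  qed simp
  then show ?thesis
    by (rule continuous_map_eq) (use mem in \<open>simp add: unloop_def\<close>)
qed

lemma unloop_boundary:
  assumes n: "n \<ge> 2" and s: "s \<in> cube_boundary (Suc n)"
    and bd: "\<And>s. s \<in> cube_boundary n \<Longrightarrow> \<beta> s = const_loop y"
  shows "unloop n \<beta> s = y"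
  using bd[OF squeeze_boundary[OF s n]] cube_boundary_subset[OF s] circle_exp_mem
  by (simp add: unloop_def const_loop_eq)

lemma unloop_homotopic:
  assumes n: "n \<ge> 2"
    and pq: "spheroid_homotopic n (free_loop_space Y y0) (const_loop y0) p q"
  shows "spheroid_homotopic (Suc n) Y y0 (unloop n p) (unloop n q)"
proof -
  obtain H where H: "continuous_map (prod_topology unit_interval (cube n)) (free_loop_space Y y0) H"
    "\<And>s. s \<in> topspace (cube n) \<Longrightarrow> H (0, s) = p s"
    "\<And>s. s \<in> topspace (cube n) \<Longrightarrow> H (1, s) = q s"
    "\<And>u s. 0 \<le> u \<Longrightarrow> u \<le> 1 \<Longrightarrow> s \<in> cube_boundary n \<Longrightarrow> H (u, s) = const_loop y0"
    using spheroid_homotopicE[OF pq] by blast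
  let ?K = "\<lambda>d. unloop n (\<lambda>s. H (fst d, s)) (snd d)"
  show ?thesis
  proof (rule spheroid_homotopicI[where H = ?K])
    show "continuous_map (prod_topology unit_interval (cube (Suc n))) Y ?K"
      by (rule continuous_map_unloop[OF n continuous_map_free_loop_space_full[OF H(1)], where g = "\<lambda>_. y0"])
        (use H(4) in \<open>auto intro: continuous_map_fst continuous_map_snd\<close>)
    show "?K (u, s) = y0" if "0 \<le> u" "u \<le> 1" "s \<in> cube_boundary (Suc n)" for u s
      using unloop_boundary[OF n that(3), of "\<lambda>s. H (u, s)"] H(4) that by simp
  qed (simp_all add: unloop_def squeeze_mem n H(2,3))
qed

lemma unloop_spheroids:
  assumes "n \<ge> 2" "p \<in> spheroids n (free_loop_space Y y0) (const_loop y0)"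
  shows "unloop n p \<in> spheroids (Suc n) Y y0"
  using unloop_homotopic[OF assms(1) spheroidsD(4)[OF assms(2)]]
  by (simp add: spheroids_iff unloop_def)

definition unloop_map ::
    "nat \<Rightarrow> 'a topology \<Rightarrow> 'a \<Rightarrow> ((nat \<Rightarrow> real) \<Rightarrow> complex \<Rightarrow> 'a) set \<Rightarrow> ((nat \<Rightarrow> real) \<Rightarrow> 'a) set" where
  "unloop_map n Y y0 A = (\<Union>p\<in>A. spheroid_class (Suc n) Y y0 (unloop n p))"

lemma unloop_map_class:
  assumes n: "n \<ge> 2" and p: "p \<in> spheroids n (free_loop_space Y y0) (const_loop y0)"
  shows "unloop_map n Y y0 (spheroid_class n (free_loop_space Y y0) (const_loop y0) p) =
           spheroid_class (Suc n) Y y0 (unloop n p)"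
proof -
  have "spheroid_class (Suc n) Y y0 (unloop n q) = spheroid_class (Suc n) Y y0 (unloop n p)"
    if "q \<in> spheroid_class n (free_loop_space Y y0) (const_loop y0) p" for q
    by (rule spheroid_class_mono[OF unloop_homotopic[OF n
          homotopic_with_symD[OF spheroid_class_memD(2)[OF that]]]])
  then show ?thesis
    unfolding unloop_map_def using spheroid_class_self[OF p] by blast
qed

text \<open>
  The construction leaves coordinate \<open>0\<close> alone, which for \<open>n \<ge> 2\<close> is different from both coordinates
  that it changes.
\<close>

lemma unloop_juxtapose:
  assumes n: "n \<ge> 2"
  shows "unloop n (juxtapose n 0 p q) = juxtapose (Suc n) 0 (unloop n p) (unloop n q)"
proof
  fix s
  have upd: "squeeze n (s(0 := c)) = (squeeze n s)(0 := c)" for c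
    using n by (auto simp: squeeze_def fun_eq_iff)
  show "unloop n (juxtapose n 0 p q) s = juxtapose (Suc n) 0 (unloop n p) (unloop n q) s"
  proof (cases "s \<in> topspace (cube (Suc n))")
    case True
    have "s(0 := 2 * s 0) \<in> topspace (cube (Suc n))" if "s 0 \<le> 1/2"
      using True cube_coord[OF True, of 0] that by (auto intro!: cube_update)
    moreover have "s(0 := 2 * s 0 - 1) \<in> topspace (cube (Suc n))" if "\<not> s 0 \<le> 1/2"
      using True cube_coord[OF True, of 0] that by (auto intro!: cube_update)
    moreover have "squeeze n s 0 = s 0" using n by (simp add: squeeze_coord_other)
    ultimately show ?thesis
      using True n by (simp add: unloop_def juxtapose_def squeeze_mem upd)
  qed (simp add: unloop_def juxtapose_def)
qed

lemma unloop_map_hom: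
  assumes n: "n \<ge> 2"
  shows "unloop_map n Y y0 \<in>
           hom (homotopy_group n (free_loop_space Y y0) (const_loop y0)) (homotopy_group (Suc n) Y y0)"
proof (rule homI)
  let ?L = "free_loop_space Y y0" and ?c = "const_loop y0"
  have n1: "n \<ge> 1" "0 < n" "Suc n \<ge> 1" using n by auto
  fix x assume "x \<in> carrier (homotopy_group n ?L ?c)"
  then obtain p where p: "p \<in> spheroids n ?L ?c" "x = spheroid_class n ?L ?c p"
    by (auto simp: carrier_homotopy_group)
  show "unloop_map n Y y0 x \<in> carrier (homotopy_group (Suc n) Y y0)"
    using p unloop_spheroids[OF n p(1)] by (simp add: unloop_map_class[OF n] carrier_homotopy_group)
  fix y assume "y \<in> carrier (homotopy_group n ?L ?c)"
  then obtain q where q: "q \<in> spheroids n ?L ?c" "y = spheroid_class n ?L ?c q"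
    by (auto simp: carrier_homotopy_group)
  show "unloop_map n Y y0 (x \<otimes>\<^bsub>homotopy_group n ?L ?c\<^esub> y) =
      unloop_map n Y y0 x \<otimes>\<^bsub>homotopy_group (Suc n) Y y0\<^esub> unloop_map n Y y0 y"
    unfolding p(2) q(2) mult_homotopy_group[OF n1(1) p(1) q(1)] unloop_map_class[OF n p(1)]
      unloop_map_class[OF n q(1)] unloop_map_class[OF n juxtapose_spheroids[OF n1(2) p(1) q(1)]]
      mult_homotopy_group[OF n1(3) unloop_spheroids[OF n p(1)] unloop_spheroids[OF n q(1)]]
    by (simp add: unloop_juxtapose[OF n])
qed

lemma continuous_map_into_free_loop_space:
  assumes n: "n \<ge> 1" and M: "continuous_map (prod_topology Z (cube n)) (compact_open_topology circle Y) M"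
    and bd: "\<And>z s. z \<in> topspace Z \<Longrightarrow> s \<in> cube_boundary n \<Longrightarrow>
               M (z, s) \<in> path_component_of_set (compact_open_topology circle Y) (const_loop y0)"
  shows "continuous_map (prod_topology Z (cube n)) (free_loop_space Y y0) M"
proof -
  let ?b = "\<lambda>i\<in>{..<n}. 0::real"
  have b: "?b \<in> cube_boundary n" by (rule cube_boundary_nonempty[OF n])
  have "M (z, s) \<in> path_component_of_set (compact_open_topology circle Y) (const_loop y0)"
    if "z \<in> topspace Z" "s \<in> topspace (cube n)" for z s
  proof -
    have "continuous_map (cube n) (compact_open_topology circle Y) (\<lambda>s. M (z, s))"
      using continuous_map_o_Pair[OF M that(1)] by (simp add: o_def)
    from path_component_cube[OF this cube_boundary_subset[OF b] that(2) bd[OF that(1) b]]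
    show ?thesis .
  qed
  then show ?thesis
    unfolding free_loop_space_eq continuous_map_in_subtopology using M by auto
qed

text \<open>
  On based loops the passage to one dimension less is plain currying of the last coordinate.
\<close>

definition looping :: "nat \<Rightarrow> ((nat \<Rightarrow> real) \<Rightarrow> 'a) \<Rightarrow> (nat \<Rightarrow> real) \<Rightarrow> complex \<Rightarrow> 'a" where
  "looping n b = (\<lambda>s\<in>topspace (cube n). \<lambda>w\<in>topspace circle. b (s(n := circle_arg w)))"

text \<open>
  The last property, that all loops of the homotopy are based at \<open>y0\<close>, allows the homotopy to be
  paired with a constant map to \<open>X\<close> inside the relative free loop space.
\<close>

lemma looping_homotopy:
  assumes n: "n \<ge> 1" and y0: "y0 \<in> topspace Y" and pq: "spheroid_homotopic (Suc n) Y y0 p q"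
  obtains M where "continuous_map (prod_topology unit_interval (cube n)) (free_loop_space Y y0) M"
    "\<And>s. s \<in> topspace (cube n) \<Longrightarrow> M (0, s) = looping n p s"
    "\<And>s. s \<in> topspace (cube n) \<Longrightarrow> M (1, s) = looping n q s"
    "\<And>u s. 0 \<le> u \<Longrightarrow> u \<le> 1 \<Longrightarrow> s \<in> cube_boundary n \<Longrightarrow> M (u, s) = const_loop y0"
    "\<And>u s. 0 \<le> u \<Longrightarrow> u \<le> 1 \<Longrightarrow> s \<in> topspace (cube n) \<Longrightarrow> M (u, s) 1 = y0"
proof -
  obtain H where H: "continuous_map (prod_topology unit_interval (cube (Suc n))) Y H"
    "\<And>s. s \<in> topspace (cube (Suc n)) \<Longrightarrow> H (0, s) = p s"
    "\<And>s. s \<in> topspace (cube (Suc n)) \<Longrightarrow> H (1, s) = q s"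
    "\<And>u s. 0 \<le> u \<Longrightarrow> u \<le> 1 \<Longrightarrow> s \<in> cube_boundary (Suc n) \<Longrightarrow> H (u, s) = y0"
    using spheroid_homotopicE[OF pq] by blast
  let ?D = "prod_topology unit_interval (cube n)"
  let ?G = "\<lambda>(d, t). H (fst d, (snd d)(n := t))"
  let ?M = "\<lambda>d. \<lambda>w\<in>topspace circle. ?G (d, circle_arg w)"
  have "continuous_map (prod_topology ?D unit_interval) (prod_topology unit_interval (cube (Suc n)))
      (\<lambda>e. (fst (fst e), (snd (fst e))(n := snd e)))"
    by (intro continuous_map_pairedI continuous_map_cube_extend continuous_map_unit_interval_real
          continuous_map_compose[OF continuous_map_fst continuous_map_fst, unfolded o_def]
          continuous_map_compose[OF continuous_map_fst continuous_map_snd, unfolded o_def]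
          continuous_map_snd) auto
  from continuous_map_compose[OF this H(1)]
  have G: "continuous_map (prod_topology ?D unit_interval) Y ?G"
    by (simp add: o_def case_prod_unfold)
  have bdM: "?M (u, s) = const_loop y0" if "0 \<le> u" "u \<le> 1" "s \<in> cube_boundary n" for u s
    using that circle_arg_mem by (auto simp: const_loop_def fun_eq_iff intro!: H(4) cube_extend_boundary)
  have M: "continuous_map ?D (free_loop_space Y y0) ?M"
  proof (rule continuous_map_into_free_loop_space[OF n])
    show "continuous_map ?D (compact_open_topology circle Y) ?M"
      by (rule continuous_map_into_loops[OF G])
        (auto simp: H(4) cube_extend_ends simp del: fun_upd_apply)
    show "?M (u, s) \<in> path_component_of_set (compact_open_topology circle Y) (const_loop y0)"
      if "u \<in> topspace unit_interval" "s \<in> cube_boundary n" for u s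
      using that bdM[of u s] const_loop_component[OF y0] by simp
  qed
  have arg: "s(n := circle_arg w) \<in> topspace (cube (Suc n))" if "s \<in> topspace (cube n)" for s w
    using that circle_arg_mem[of w] by (intro cube_extend) auto
  show ?thesis
    by (rule that[OF M _ _ bdM])
      (auto simp: looping_def fun_eq_iff H arg cube_extend_ends simp del: fun_upd_apply)
qed

text \<open>
  Composing \<open>unloop\<close> with \<open>looping\<close> precomposes with a self-map of the cube that is homotopic to
  the identity: first the plateau factor is raised to \<open>1\<close>, then both coordinates are straightened.
\<close>

lemma unloop_looping:
  assumes n: "n \<ge> 2" and b: "b \<in> spheroids (Suc n) Y y0"
  shows "spheroid_homotopic (Suc n) Y y0 (unloop n (looping n b)) b"
proof -
  have n1: "1 < Suc n" "n < Suc n" "1 \<noteq> n" "n \<noteq> 1" "1 < n" using n by auto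
  let ?N = "cube (Suc n)"
  let ?D = "prod_topology unit_interval ?N"
  let ?\<Phi> = "\<lambda>(u, s). s(1 := min (2 * s 1) ((1 - u) * plateau (s n) + u), n := middle (s n))"
  let ?q = "\<lambda>s\<in>topspace ?N. b (s(n := middle (s n)))"
  have bounds: "0 \<le> min (2 * s 1) ((1 - u) * plateau (s n) + u) \<and>
      min (2 * s 1) ((1 - u) * plateau (s n) + u) \<le> 1"
    if "0 \<le> u" "u \<le> 1" "s \<in> topspace ?N" for u s
  proof -
    have "0 \<le> plateau (s n)" "plateau (s n) \<le> 1"
      using plateau_bounds[of "s n"] cube_coord[OF that(3), of n] by auto
    then have "0 \<le> (1 - u) * plateau (s n) + u" "(1 - u) * plateau (s n) + u \<le> 1"
      using that convex_bound_le[of "plateau (s n)" 1 1 "1 - u" u] by auto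
    then show ?thesis using cube_coord[OF that(3) n1(1)] by (auto simp: min_def)
  qed
  have \<Phi>_mem: "?\<Phi> (u, s) \<in> topspace ?N" if "0 \<le> u" "u \<le> 1" "s \<in> topspace ?N" for u s
    using bounds[OF that] middle_bounds[of "s n"] that(3) n1
    by (auto intro!: cube_update simp del: fun_upd_apply)
  have 1: "spheroid_homotopic (Suc n) Y y0 (unloop n (looping n b))
      (\<lambda>s. ?q (s(1 := min 1 (2 * s 1))))"
  proof (rule spheroid_reparametrize[OF b, where \<Phi> = ?\<Phi>])
    have s: "continuous_map ?D euclideanreal (\<lambda>z. snd z 1)" "continuous_map ?D euclideanreal (\<lambda>z. snd z n)"
      by (rule continuous_map_coordinate[OF continuous_map_snd n1(1)],
          rule continuous_map_coordinate[OF continuous_map_snd n1(2)])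
    have u: "continuous_map ?D euclideanreal fst"
      by (rule continuous_map_unit_interval_real[OF continuous_map_fst])
    show "continuous_map ?D ?N ?\<Phi>"
      unfolding case_prod_unfold
      by (intro continuous_map_cube_update continuous_map_snd continuous_intros s u
            continuous_map_plateau continuous_map_middle n1)
        (use bounds middle_bounds in auto)
    fix u :: real and s assume u: "0 \<le> u" "u \<le> 1" and s: "s \<in> cube_boundary (Suc n)"
    have s': "s \<in> topspace ?N" using s by (rule cube_boundary_subset)
    obtain i where i: "i < Suc n" "s i = 0 \<or> s i = 1" using s by (auto simp: cube_boundary_def)
    define r where "r = ?\<Phi> (u, s)"
    have coord: "r n = middle (s n)" "r 1 = min (2 * s 1) ((1 - u) * plateau (s n) + u)"
        "i \<noteq> 1 \<Longrightarrow> i \<noteq> n \<Longrightarrow> r i = s i"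
      using n1 by (auto simp: r_def)
    have "\<exists>i<Suc n. r i = 0 \<or> r i = 1"
    proof (cases "i = 1 \<and> s i = 1 \<and> plateau (s n) = 1 \<or> i = 1 \<and> s i = 0")
      case True
      have "0 \<le> (1 - u) * plateau (s n) + u" using bounds[OF u s'] by auto
      with True have "r 1 = 1 \<or> r 1 = 0"
        unfolding coord(2) by (auto simp: algebra_simps)
      then show ?thesis using n1(1) by blast
    next
      case False
      show ?thesis
      proof (cases "i = 1 \<or> i = n")
        case True
        have "middle (s n) = 0 \<or> middle (s n) = 1"
          using True False i middle_end[of "s n"] by auto
        then have "r n = 0 \<or> r n = 1" by (simp only: coord(1))
        then show ?thesis using n1(2) by blast
      next
        case False
        then have "r i = 0 \<or> r i = 1" using coord(3) i(2) by simp
        then show ?thesis using i(1) by blast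
      qed
    qed
    moreover have "r \<in> topspace ?N" unfolding r_def by (rule \<Phi>_mem[OF u s'])
    ultimately have "r \<in> cube_boundary (Suc n)" by (simp add: cube_boundary_def)
    then show "b (?\<Phi> (u, s)) = y0" unfolding r_def by (rule spheroidsD(3)[OF b])
  next
    fix s assume s: "s \<in> topspace ?N"
    have "s(1 := min 1 (2 * s 1)) \<in> topspace ?N"
      using s n1 cube_coord[OF s n1(1)] by (intro cube_update) auto
    then show "?q (s(1 := min 1 (2 * s 1))) = b (?\<Phi> (1, s))"
      using n1 by (simp add: min.commute)
    have S: "squeeze n s \<in> topspace (cube n)" by (rule squeeze_mem[OF s n])
    have Supd: "(squeeze n s)(n := c) = s(1 := min (min (2 * s 1) (2 - 2 * s 1)) (plateau (s n)), n := c)" for c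
      using s n1 by (auto simp: squeeze_def fun_eq_iff topspace_cube PiE_iff extensional_def)
    have glue: "b ((squeeze n s)(n := circle_arg (circle_exp (middle (s n))))) = b ((squeeze n s)(n := middle (s n)))"
    proof -
      have "b ((squeeze n s)(n := 0)) = y0" "b ((squeeze n s)(n := 1)) = y0"
        using S by (auto intro!: spheroidsD(3)[OF b] cube_extend_ends)
      then show ?thesis
        using glue_circle_arg[of "\<lambda>(z, t). b (z(n := t))" "squeeze n s" "middle (s n)"]
          middle_bounds[of "s n"] by simp
    qed
    show "unloop n (looping n b) s = b (?\<Phi> (0, s))"
    proof (cases "s 1 \<le> 1/2")
      case True
      then have "unloop n (looping n b) s = b ((squeeze n s)(n := middle (s n)))"
        using s S circle_exp_mem by (simp add: unloop_def looping_def glue del: fun_upd_apply)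
      also have "\<dots> = b (?\<Phi> (0, s))"
        using True unfolding Supd by (simp add: min_def)
      finally show ?thesis .
    next
      case False
      then have "unloop n (looping n b) s = b ((squeeze n s)(n := 0))"
        using s S by (simp add: unloop_def looping_def del: fun_upd_apply)
      also have "\<dots> = y0" using S by (auto intro!: spheroidsD(3)[OF b] cube_extend_ends)
      also have "y0 = b (?\<Phi> (0, s))"
      proof (rule spheroidsD(3)[OF b, symmetric])
        define r where "r = ?\<Phi> (0, s)"
        have coord: "r n = middle (s n)" "r 1 = min (2 * s 1) (plateau (s n))"
          using n1 by (auto simp: r_def)
        have "r 1 = 1 \<or> r n = 0 \<or> r n = 1"
        proof (cases "plateau (s n) = 1")
          case True
          then show ?thesis using False unfolding coord by simp
        next
          case False
          then show ?thesis using middle_end[OF False] unfolding coord by blast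
        qed
        moreover have "r \<in> topspace ?N"
          unfolding r_def by (rule \<Phi>_mem) (use s in auto)
        ultimately have "r \<in> cube_boundary (Suc n)"
          unfolding cube_boundary_def using n1 by blast
        then show "?\<Phi> (0, s) \<in> cube_boundary (Suc n)" unfolding r_def .
      qed
      finally show ?thesis .
    qed
  qed
  have mid: "continuous_on {0..1} middle"
    unfolding middle_def by (intro continuous_intros)
  have 3: "spheroid_homotopic (Suc n) Y y0 ?q b"
    by (rule spheroid_reparametrize_coordinate[OF b n1(2), of middle "\<lambda>x. x"])
      (use mid middle_bounds in auto)
  have q: "?q \<in> spheroids (Suc n) Y y0"
    using homotopic_with_imp_continuous_maps[OF 3] homotopic_with_imp_property[OF 3]
    by (auto simp: spheroids_def)
  have cmin: "continuous_on {0..1} (\<lambda>x::real. min 1 (2 * x))" by (intro continuous_intros)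
  have 2: "spheroid_homotopic (Suc n) Y y0 (\<lambda>s. ?q (s(1 := min 1 (2 * s 1)))) ?q"
    by (rule spheroid_reparametrize_coordinate[OF q n1(1), of "\<lambda>x. min 1 (2 * x)" "\<lambda>x. x"])
      (use cmin in auto)
  show ?thesis
    using homotopic_with_trans[OF 1 homotopic_with_trans[OF 2 3]] .
qed

text \<open>
  On constant loops both halves of the juxtaposition have the same values, so \<open>unloop\<close> factors through
  \<open>squeeze\<close>, whose coordinate \<open>1\<close> starts and ends at \<open>0\<close> and hence contracts to \<open>0\<close>.
\<close>

lemma unloop_const_loops:
  assumes n: "n \<ge> 2" and a: "a \<in> spheroids n Y y0"
  shows "spheroid_homotopic (Suc n) Y y0 (unloop n (\<lambda>s\<in>topspace (cube n). const_loop (a s)))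
           (const_spheroid (Suc n) y0)"
proof (rule spheroid_reparametrize[OF a])
  let ?D = "prod_topology unit_interval (cube (Suc n))"
  let ?\<Phi> = "\<lambda>(u, s). (squeeze n s)(1 := (1 - u) * squeeze n s 1)"
  have n1: "1 < n" using n by simp
  have sq: "continuous_map ?D (cube n) (\<lambda>z. squeeze n (snd z))"
    by (intro continuous_map_squeeze continuous_map_snd n)
  have u: "continuous_map ?D euclideanreal fst"
    by (rule continuous_map_unit_interval_real[OF continuous_map_fst])
  have bounds: "0 \<le> (1 - u) * squeeze n s 1 \<and> (1 - u) * squeeze n s 1 \<le> 1"
    if "0 \<le> u" "u \<le> 1" "s \<in> topspace (cube (Suc n))" for u s
    using cube_coord[OF squeeze_mem[OF that(3) n] n1] that by (auto intro!: mult_le_one)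
  show "continuous_map ?D (cube n) ?\<Phi>"
    unfolding case_prod_unfold
    by (intro continuous_map_cube_update sq continuous_intros u continuous_map_coordinate[OF sq] n1)
      (use bounds in auto)
  show "a (?\<Phi> (u, s)) = y0" if u: "0 \<le> u" "u \<le> 1" and s: "s \<in> cube_boundary (Suc n)" for u s
  proof (rule spheroidsD(3)[OF a])
    have "?\<Phi> (u, s) \<in> topspace (cube n)"
      using bounds[OF u cube_boundary_subset[OF s]] squeeze_mem[OF cube_boundary_subset[OF s] n] n1
      by (simp add: cube_update del: fun_upd_apply)
    moreover have "?\<Phi> (u, s) 1 = 0 \<or> (\<exists>i<n. i \<noteq> 1 \<and> (?\<Phi> (u, s) i = 0 \<or> ?\<Phi> (u, s) i = 1))"
      using squeeze_boundary_cases[OF s n] by auto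
    ultimately show "?\<Phi> (u, s) \<in> cube_boundary n"
      unfolding cube_boundary_def using n1 by blast
  qed
  fix s assume s: "s \<in> topspace (cube (Suc n))"
  show "unloop n (\<lambda>s\<in>topspace (cube n). const_loop (a s)) s = a (?\<Phi> (0, s))"
    using s squeeze_mem[OF s n] circle_exp_mem by (simp add: unloop_def const_loop_eq)
  have "(squeeze n s)(1 := 0) \<in> cube_boundary n"
    by (rule cube_boundary_update[OF squeeze_mem[OF s n] n1]) simp
  then show "const_spheroid (Suc n) y0 s = a (?\<Phi> (1, s))"
    using s spheroidsD(3)[OF a] by (simp add: const_spheroid_def del: fun_upd_apply)
qed

text \<open>
  A homotopy \<open>K\<close> that contracts the base points of a family of loops turns the loops into based
  ones by conjugation: the loop \<open>\<beta> s\<close> is preceded by \<open>K\<close> run backwards and followed by \<open>K\<close>.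
  At time \<open>u\<close> only the part of \<open>K\<close> up to time \<open>u\<close> is used.
\<close>

lemma straighten_loops:
  assumes n: "n \<ge> 1" and y0: "y0 \<in> topspace Y"
    and \<beta>: "\<beta> \<in> spheroids n (free_loop_space Y y0) (const_loop y0)"
    and K: "continuous_map (prod_topology unit_interval (cube n)) Y K"
    and K0: "\<And>s. s \<in> topspace (cube n) \<Longrightarrow> K (0, s) = \<beta> s 1"
    and K1: "\<And>s. s \<in> topspace (cube n) \<Longrightarrow> K (1, s) = y0"
    and Kbd: "\<And>u s. 0 \<le> u \<Longrightarrow> u \<le> 1 \<Longrightarrow> s \<in> cube_boundary n \<Longrightarrow> K (u, s) = y0"
  obtains b M where "b \<in> spheroids (Suc n) Y y0"
    "continuous_map (prod_topology unit_interval (cube n)) (free_loop_space Y y0) M"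
    "\<And>s. s \<in> topspace (cube n) \<Longrightarrow> M (0, s) = \<beta> s"
    "\<And>s. s \<in> topspace (cube n) \<Longrightarrow> M (1, s) = looping n b s"
    "\<And>u s. 0 \<le> u \<Longrightarrow> u \<le> 1 \<Longrightarrow> s \<in> topspace (cube n) \<Longrightarrow> M (u, s) 1 = K (u, s)"
    "\<And>u s. 0 \<le> u \<Longrightarrow> u \<le> 1 \<Longrightarrow> s \<in> cube_boundary n \<Longrightarrow> M (u, s) = const_loop y0"
proof -
  define cl where "cl x = max 0 (min 1 x)" for x :: real
  define W where "W s x = (if x \<le> 0 then K (cl (- x), s) else
      if x \<le> 1 then \<beta> s (circle_exp (cl x)) else K (cl (x - 1), s))" for s x
  have cl: "0 \<le> cl x \<and> cl x \<le> 1" for x by (auto simp: cl_def)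
  have \<beta>c: "continuous_map (cube n) (compact_open_topology circle Y) \<beta>"
    by (rule continuous_map_free_loop_space_full[OF spheroidsD(1)[OF \<beta>]])
  have W: "continuous_map S Y (\<lambda>d. W (\<sigma> d) (x d))"
    if \<sigma>: "continuous_map S (cube n) \<sigma>" and x: "continuous_map S euclideanreal x"
    for S :: "'s topology" and \<sigma> x
  proof -
    have mem: "\<sigma> d \<in> topspace (cube n)" if "d \<in> topspace S" for d
      using continuous_map_image_subset_topspace[OF \<sigma>] that by blast
    have clc: "continuous_map S unit_interval (\<lambda>d. cl (\<phi> d))"
      if "continuous_map S euclideanreal \<phi>" for \<phi>
    proof (rule continuous_map_into_unit_interval)
      show "continuous_map S euclideanreal (\<lambda>d. cl (\<phi> d))"
        unfolding cl_def by (intro continuous_intros that) auto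
    qed (rule cl)
    have Kc: "continuous_map S Y (\<lambda>d. K (cl (\<phi> d), \<sigma> d))"
      if "continuous_map S euclideanreal \<phi>" for \<phi>
      using continuous_map_compose[OF continuous_map_pairedI[OF clc[OF that] \<sigma>] K] by (simp add: o_def)
    have e: "continuous_map S circle (\<lambda>d. circle_exp (cl (x d)))"
      using continuous_map_compose[OF clc[OF x] continuous_map_circle_exp] by (simp add: o_def)
    have \<beta>e: "continuous_map S Y (\<lambda>d. \<beta> (\<sigma> d) (circle_exp (cl (x d))))"
      by (rule continuous_map_uncurry[OF neighbourhood_base_circle \<beta>c \<sigma> e])
    have inner: "continuous_map S Y (\<lambda>d. if x d \<le> 1 then \<beta> (\<sigma> d) (circle_exp (cl (x d)))
        else K (cl (x d - 1), \<sigma> d))"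
    proof (rule continuous_map_cases_le[OF x])
      show "continuous_map (subtopology S {d \<in> topspace S. x d \<le> 1}) Y (\<lambda>d. \<beta> (\<sigma> d) (circle_exp (cl (x d))))"
        by (rule continuous_map_from_subtopology[OF \<beta>e])
      show "continuous_map (subtopology S {d \<in> topspace S. 1 \<le> x d}) Y (\<lambda>d. K (cl (x d - 1), \<sigma> d))"
        by (intro continuous_map_from_subtopology Kc continuous_intros x) auto
      show "\<beta> (\<sigma> d) (circle_exp (cl (x d))) = K (cl (x d - 1), \<sigma> d)" if "d \<in> topspace S" "x d = 1" for d
        using that K0[OF mem[OF that(1)]] by (simp add: cl_def)
    qed simp
    show ?thesis
      unfolding W_def
    proof (rule continuous_map_cases_le[OF x])
      show "continuous_map (subtopology S {d \<in> topspace S. x d \<le> 0}) Y (\<lambda>d. K (cl (- x d), \<sigma> d))"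
        by (intro continuous_map_from_subtopology Kc continuous_intros x)
      show "continuous_map (subtopology S {d \<in> topspace S. 0 \<le> x d}) Y
          (\<lambda>d. if x d \<le> 1 then \<beta> (\<sigma> d) (circle_exp (cl (x d))) else K (cl (x d - 1), \<sigma> d))"
        by (rule continuous_map_from_subtopology[OF inner])
      show "K (cl (- x d), \<sigma> d) = (if x d \<le> 1 then \<beta> (\<sigma> d) (circle_exp (cl (x d)))
          else K (cl (x d - 1), \<sigma> d))" if "d \<in> topspace S" "x d = 0" for d
        using that K0[OF mem[OF that(1)]] by (simp add: cl_def)
    qed simp
  qed
  have Wbd: "W s x = y0" if "s \<in> cube_boundary n" for s x
    using Kbd[OF _ _ that] cl spheroidsD(3)[OF \<beta> that] circle_exp_mem
    by (simp add: W_def const_loop_eq)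
  define b where "b = (\<lambda>s\<in>topspace (cube (Suc n)). W (restrict s {..<n}) (3 * s n - 1))"
  let ?D = "prod_topology unit_interval (cube n)"
  \<comment> \<open>\<open>W s\<close> is the full conjugated path on \<open>[-1, 2]\<close>, with \<open>\<beta> s\<close> on \<open>[0, 1]\<close>; stage \<open>u\<close> runs it over
    \<open>[-u, 1 + u]\<close>.\<close>
  let ?G = "\<lambda>(d, t). W (snd d) ((1 + 2 * fst d) * t - fst d)"
  define M where "M = (\<lambda>d. \<lambda>w\<in>topspace circle. ?G (d, circle_arg w))"
  have b: "b \<in> spheroids (Suc n) Y y0"
    unfolding b_def
  proof (rule spheroids_restrictI)
    show "continuous_map (cube (Suc n)) Y (\<lambda>s. W (restrict s {..<n}) (3 * s n - 1))"
      by (intro W continuous_map_cube_truncate continuous_intros continuous_map_coordinate) auto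
    fix s assume s: "s \<in> cube_boundary (Suc n)"
    have tr: "restrict s {..<n} \<in> topspace (cube n)"
      by (rule cube_truncate[OF cube_boundary_subset[OF s]])
    show "W (restrict s {..<n}) (3 * s n - 1) = y0"
    proof (cases "s n = 0 \<or> s n = 1")
      case True
      then show ?thesis using K1[OF tr] by (auto simp: W_def cl_def)
    next
      case False
      then have "\<exists>i<n. s i = 0 \<or> s i = 1"
        using s by (auto simp: cube_boundary_def less_Suc_eq)
      then have "restrict s {..<n} \<in> cube_boundary n"
        using tr by (auto simp: cube_boundary_def)
      then show ?thesis by (rule Wbd)
    qed
  qed
  have Mbd: "M (u, s) = const_loop y0" if "0 \<le> u" "u \<le> 1" "s \<in> cube_boundary n" for u s
    using Wbd[OF that(3)] by (auto simp: M_def const_loop_def)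
  have M: "continuous_map ?D (free_loop_space Y y0) M"
  proof (rule continuous_map_into_free_loop_space[OF n])
    let ?E = "prod_topology ?D unit_interval"
    have c: "continuous_map ?E (cube n) (\<lambda>e. snd (fst e))"
      "continuous_map ?E euclideanreal (\<lambda>e. fst (fst e))" "continuous_map ?E euclideanreal snd"
      using continuous_map_compose[OF continuous_map_fst continuous_map_snd, of unit_interval "cube n" unit_interval]
        continuous_map_compose[OF continuous_map_fst continuous_map_fst, of unit_interval "cube n" unit_interval]
      by (auto simp: o_def intro!: continuous_map_unit_interval_real continuous_map_snd)
    have "continuous_map ?E Y (\<lambda>e. W (snd (fst e)) ((1 + 2 * fst (fst e)) * snd e - fst (fst e)))"
      by (intro W c continuous_intros) auto
    then have G: "continuous_map ?E Y ?G" by (simp add: case_prod_unfold)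
    show "continuous_map ?D (compact_open_topology circle Y) M"
      unfolding M_def
      by (rule continuous_map_into_loops[OF G]) (auto simp: W_def K0 cl_def)
    show "M (u, s) \<in> path_component_of_set (compact_open_topology circle Y) (const_loop y0)"
      if "u \<in> topspace unit_interval" "s \<in> cube_boundary n" for u s
      using that Mbd[of u s] const_loop_component[OF y0] by simp
  qed
  show ?thesis
  proof (rule that[OF b M _ _ _ Mbd])
    fix s assume s: "s \<in> topspace (cube n)"
    have \<beta>ext: "\<beta> s \<in> extensional (topspace circle)"
      by (rule continuous_map_compact_open_mem[OF \<beta>c s])
    have "W s (circle_arg w) = \<beta> s w" if "w \<in> sphere 0 1" for w
    proof (cases "circle_arg w = 0")
      case True
      then have "w = 1" using circle_exp_arg[OF that] by simp
      then show ?thesis using True K0[OF s] by (simp add: W_def cl_def)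
    next
      case False
      then show ?thesis
        using circle_arg_bounds[of w] circle_exp_arg[OF that] by (simp add: W_def cl_def)
    qed
    then show "M (0, s) = \<beta> s"
      using \<beta>ext by (auto simp: M_def fun_eq_iff extensional_def)
    have "b (s(n := circle_arg w)) = W s (3 * circle_arg w - 1)" for w
    proof -
      have "s(n := circle_arg w) \<in> topspace (cube (Suc n))"
        using circle_arg_mem[of w] by (intro cube_extend s) auto
      moreover have "restrict (s(n := circle_arg w)) {..<n} = s"
        using s by (auto simp: topspace_cube PiE_iff extensional_def fun_eq_iff)
      ultimately show ?thesis by (simp add: b_def)
    qed
    then show "M (1, s) = looping n b s"
      using s by (simp add: M_def looping_def)
    show "M (u, s) 1 = K (u, s)" if "0 \<le> u" "u \<le> 1" for u
      using that by (auto simp: M_def W_def cl_def min_def)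
  qed
qed

section \<open>The relative free loop space\<close>

lemma path_component_of_set_image:
  assumes h: "continuous_map S T h" and x: "x \<in> path_component_of_set S c"
  shows "h x \<in> path_component_of_set T (h c)"
proof -
  obtain g where "pathin S g" "g 0 = c" "g 1 = x" using x by (auto simp: path_component_of_def)
  then have "pathin T (h \<circ> g)" "(h \<circ> g) 0 = h c" "(h \<circ> g) 1 = h x"
    using h by (auto intro: continuous_map_compose simp: pathin_def)
  then show ?thesis by (auto simp: path_component_of_def)
qed

lemma path_component_of_set_path_connected:
  "path_connected_space S \<Longrightarrow> x \<in> topspace S \<Longrightarrow> c \<in> topspace S \<Longrightarrow> x \<in> path_component_of_set S c"
  by (simp add: path_connected_space_iff_path_component)

locale relative_loops =
  fixes X :: "'a topology" and Y :: "'b topology" and f :: "'a \<Rightarrow> 'b" and x0 :: 'a and y0 :: 'b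
  assumes f: "continuous_map X Y f" and f_base: "f x0 = y0"
    and x0: "x0 \<in> topspace X" and path_connected: "path_connected_space X"
begin

abbreviation "LX \<equiv> free_loop_space X x0"
abbreviation "LY \<equiv> free_loop_space Y y0"
abbreviation "L \<equiv> relative_free_loop_space X Y f y0"
abbreviation "base \<equiv> (x0, const_loop y0)"

lemma f_mem: "x \<in> topspace X \<Longrightarrow> f x \<in> topspace Y"
  using continuous_map_image_subset_topspace[OF f] by blast

lemma y0: "y0 \<in> topspace Y"
  using f_mem[OF x0] f_base by simp

lemma continuous_map_into_L:
  assumes "continuous_map D X a" "continuous_map D LY b" "\<And>d. d \<in> topspace D \<Longrightarrow> f (a d) = b d 1"
  shows "continuous_map D L (\<lambda>d. (a d, b d))"
  unfolding relative_free_loop_space_def continuous_map_in_subtopology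
  using assms by (auto simp: continuous_map_paired)

lemma continuous_map_fst_L: "continuous_map L X fst"
  and continuous_map_snd_L: "continuous_map L LY snd"
  unfolding relative_free_loop_space_def
  by (intro continuous_map_from_subtopology continuous_map_fst continuous_map_snd)+

lemma L_matching: "p \<in> topspace L \<Longrightarrow> f (fst p) = snd p 1"
  by (auto simp: relative_free_loop_space_def)

lemma base_mem: "base \<in> topspace L"
proof -
  have "const_loop y0 \<in> topspace LY"
    using const_loop_mem[OF y0] const_loop_component[OF y0] by (simp add: free_loop_space_eq)
  then show ?thesis
    using x0 f_base by (simp add: relative_free_loop_space_def const_loop_eq)
qed

lemma continuous_map_const_loop: "continuous_map X LX const_loop"
proof -
  have "continuous_map X (compact_open_topology circle X) (\<lambda>x. \<lambda>w\<in>topspace circle. fst (x, w))"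
    by (rule continuous_map_curry[OF continuous_map_fst])
  then have c: "continuous_map X (compact_open_topology circle X) const_loop"
    by (simp add: const_loop_def[abs_def])
  have "const_loop x \<in> path_component_of_set (compact_open_topology circle X) (const_loop x0)"
    if "x \<in> topspace X" for x
    by (rule path_component_of_set_image[OF c path_component_of_set_path_connected[OF path_connected that x0]])
  then show ?thesis
    unfolding free_loop_space_eq continuous_map_in_subtopology using c by blast
qed

lemma const_loop_LX: "x \<in> topspace X \<Longrightarrow> const_loop x \<in> topspace LX"
  using continuous_map_image_subset_topspace[OF continuous_map_const_loop] by blast

lemma continuous_map_loop_eval:
  assumes "continuous_map S LX \<alpha>" "continuous_map S circle w"
  shows "continuous_map S X (\<lambda>d. \<alpha> d (w d))"
  by (rule continuous_map_uncurry[OF neighbourhood_base_circle continuous_map_from_free_loop_space assms])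

text \<open>
  Composition with \<open>f\<close> is continuous on the full loop spaces, hence respects their path components.
\<close>

lemma compose_loop_component:
  assumes \<alpha>: "\<alpha> \<in> topspace LX"
  shows "restrict (f \<circ> \<alpha>) (topspace circle)
           \<in> path_component_of_set (compact_open_topology circle Y) (const_loop y0)"
proof -
  let ?C = "compact_open_topology circle X"
  have "continuous_map (prod_topology ?C circle) Y (f \<circ> (\<lambda>(g, u). g u))"
    by (rule continuous_map_compose[OF continuous_map_compact_open_eval[OF neighbourhood_base_circle] f])
  from continuous_map_curry[OF this]
  have c: "continuous_map ?C (compact_open_topology circle Y) (\<lambda>\<alpha>. restrict (f \<circ> \<alpha>) (topspace circle))"
    by (simp add: o_def)
  have "\<alpha> \<in> path_component_of_set ?C (const_loop x0)"
    using \<alpha> by (simp add: free_loop_space_eq)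
  from path_component_of_set_image[OF c this]
  have "restrict (f \<circ> \<alpha>) (topspace circle) \<in> path_component_of_set (compact_open_topology circle Y)
      (restrict (f \<circ> const_loop x0) (topspace circle))" .
  moreover have "restrict (f \<circ> const_loop x0) (topspace circle) = const_loop y0"
    using f_base by (auto simp: const_loop_def)
  ultimately show ?thesis by simp
qed

lemma whisker_map_const_loop: "whisker_map f (const_loop x) = (x, const_loop (f x))"
  by (auto simp: whisker_map_def const_loop_def)

lemma whisker_map_base: "whisker_map f (const_loop x0) = base"
  by (simp add: whisker_map_const_loop f_base)

lemma continuous_map_whisker: "continuous_map LX L (whisker_map f)"
  unfolding whisker_map_def[abs_def]
proof (rule continuous_map_into_L)
  show "continuous_map LX X (\<lambda>\<alpha>. \<alpha> 1)"
    by (rule continuous_map_loop_eval) auto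
  have "continuous_map (prod_topology LX circle) Y (\<lambda>d. f (fst d (snd d)))"
    using continuous_map_compose[OF continuous_map_loop_eval[OF continuous_map_fst continuous_map_snd] f]
    by (simp add: o_def)
  from continuous_map_curry[OF this]
  have "continuous_map LX (compact_open_topology circle Y) (\<lambda>\<alpha>. restrict (f \<circ> \<alpha>) (topspace circle))"
    by (simp add: o_def)
  then show "continuous_map LX LY (\<lambda>\<alpha>. restrict (f \<circ> \<alpha>) (topspace circle))"
    unfolding free_loop_space_eq[of Y] continuous_map_in_subtopology
    using compose_loop_component by auto
qed simp

section \<open>The splitting of the homotopy groups\<close>

definition splitting ::
    "nat \<Rightarrow> ((nat \<Rightarrow> real) \<Rightarrow> 'a \<times> (complex \<Rightarrow> 'b)) set \<Rightarrow>
     ((nat \<Rightarrow> real) \<Rightarrow> 'a) set \<times> ((nat \<Rightarrow> real) \<Rightarrow> 'b) set" where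
  "splitting n A = (homotopy_group_map n X x0 fst A,
     unloop_map n Y y0 (homotopy_group_map n LY (const_loop y0) snd A))"

lemma splitting_hom:
  assumes n: "n \<ge> 2"
  shows "splitting n \<in> hom (homotopy_group n L base)
           (homotopy_group n X x0 \<times>\<times> homotopy_group (Suc n) Y y0)"
proof -
  have n1: "n \<ge> 1" using n by simp
  have 1: "homotopy_group_map n X x0 fst \<in> hom (homotopy_group n L base) (homotopy_group n X x0)"
    by (rule homotopy_group_map_hom[OF continuous_map_fst_L _ n1]) simp
  have 2: "homotopy_group_map n LY (const_loop y0) snd
      \<in> hom (homotopy_group n L base) (homotopy_group n LY (const_loop y0))"
    by (rule homotopy_group_map_hom[OF continuous_map_snd_L _ n1]) simp
  from hom_compose[OF 2 unloop_map_hom[OF n]] 1 show ?thesis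
    by (simp add: splitting_def[abs_def] hom_paired o_def)
qed

lemma splitting_class:
  assumes n: "n \<ge> 2" and p: "p \<in> spheroids n L base"
  shows "splitting n (spheroid_class n L base p) =
           (spheroid_class n X x0 (restrict (fst \<circ> p) (topspace (cube n))),
            spheroid_class (Suc n) Y y0 (unloop n (restrict (snd \<circ> p) (topspace (cube n)))))"
proof -
  have "restrict (snd \<circ> p) (topspace (cube n)) \<in> spheroids n LY (const_loop y0)"
    by (rule compose_spheroids[OF continuous_map_snd_L _ p]) simp
  then show ?thesis
    using homotopy_group_map_class[OF continuous_map_fst_L _ p, of x0]
      homotopy_group_map_class[OF continuous_map_snd_L _ p, of "const_loop y0"]
    by (simp add: splitting_def unloop_map_class[OF n])
qed

text \<open>
  If \<open>\<alpha>\<close> contracts, the contraction moves \<open>(\<alpha>, \<beta>)\<close> within \<open>L\<close> into the fibre over \<open>x0\<close>, where it is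
  \<open>(x0, looping n b)\<close>.  The second component of the splitting is homotopy invariant and recovers \<open>b\<close>,
  so \<open>b\<close> contracts too, and its contraction lifts back to the fibre.
\<close>

lemma splitting_kernel:
  assumes n: "n \<ge> 2" and A: "A \<in> carrier (homotopy_group n L base)"
    and triv: "splitting n A = \<one>\<^bsub>homotopy_group n X x0 \<times>\<times> homotopy_group (Suc n) Y y0\<^esub>"
  shows "A = \<one>\<^bsub>homotopy_group n L base\<^esub>"
proof -
  have n1: "n \<ge> 1" using n by simp
  let ?I = "topspace (cube n)"
  obtain p where p: "p \<in> spheroids n L base" and A: "A = spheroid_class n L base p"
    using A by (auto simp: carrier_homotopy_group)
  define \<alpha> where "\<alpha> = restrict (fst \<circ> p) ?I"
  define \<beta> where "\<beta> = restrict (snd \<circ> p) ?I"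
  have \<alpha>: "\<alpha> \<in> spheroids n X x0"
    unfolding \<alpha>_def by (rule compose_spheroids[OF continuous_map_fst_L _ p]) simp
  have \<beta>: "\<beta> \<in> spheroids n LY (const_loop y0)"
    unfolding \<beta>_def by (rule compose_spheroids[OF continuous_map_snd_L _ p]) simp
  have p_eq: "p s = (\<alpha> s, \<beta> s)" if "s \<in> ?I" for s
    using that by (simp add: \<alpha>_def \<beta>_def)
  have match: "f (\<alpha> s) = \<beta> s 1" if "s \<in> ?I" for s
  proof -
    have "p s \<in> topspace L"
      using continuous_map_image_subset_topspace[OF spheroidsD(1)[OF p]] that by blast
    from L_matching[OF this] show ?thesis using p_eq[OF that] by simp
  qed
  have "spheroid_class n X x0 \<alpha> = spheroid_class n X x0 (const_spheroid n x0)"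
    and "spheroid_class (Suc n) Y y0 (unloop n \<beta>) = spheroid_class (Suc n) Y y0 (const_spheroid (Suc n) y0)"
    using triv unfolding A splitting_class[OF n p] \<alpha>_def[symmetric] \<beta>_def[symmetric]
    by (simp_all add: one_homotopy_group)
  then have \<alpha>_triv: "spheroid_homotopic n X x0 \<alpha> (const_spheroid n x0)"
    and \<beta>_triv: "spheroid_homotopic (Suc n) Y y0 (unloop n \<beta>) (const_spheroid (Suc n) y0)"
    using \<alpha> unloop_spheroids[OF n \<beta>] const_spheroid_mem[OF x0] const_spheroid_mem[OF y0]
    by (simp_all add: spheroid_class_eq_iff)
  obtain H where H: "continuous_map (prod_topology unit_interval (cube n)) X H"
    "\<And>s. s \<in> ?I \<Longrightarrow> H (0, s) = \<alpha> s"
    "\<And>s. s \<in> ?I \<Longrightarrow> H (1, s) = const_spheroid n x0 s"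
    "\<And>u s. 0 \<le> u \<Longrightarrow> u \<le> 1 \<Longrightarrow> s \<in> cube_boundary n \<Longrightarrow> H (u, s) = x0"
    using spheroid_homotopicE[OF \<alpha>_triv] by blast
  have H1: "H (1, s) = x0" if "s \<in> ?I" for s
    using H(3)[OF that] that by (simp add: const_spheroid_def)
  obtain b M where b: "b \<in> spheroids (Suc n) Y y0"
    and M: "continuous_map (prod_topology unit_interval (cube n)) LY M"
      "\<And>s. s \<in> ?I \<Longrightarrow> M (0, s) = \<beta> s"
      "\<And>s. s \<in> ?I \<Longrightarrow> M (1, s) = looping n b s"
      "\<And>u s. 0 \<le> u \<Longrightarrow> u \<le> 1 \<Longrightarrow> s \<in> ?I \<Longrightarrow> M (u, s) 1 = (f \<circ> H) (u, s)"
      "\<And>u s. 0 \<le> u \<Longrightarrow> u \<le> 1 \<Longrightarrow> s \<in> cube_boundary n \<Longrightarrow> M (u, s) = const_loop y0"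
  proof (rule straighten_loops[OF n1 y0 \<beta> continuous_map_compose[OF H(1) f]])
    show "(f \<circ> H) (0, s) = \<beta> s 1" if "s \<in> ?I" for s using H(2)[OF that] match[OF that] by simp
    show "(f \<circ> H) (1, s) = y0" if "s \<in> ?I" for s using H1[OF that] f_base by simp
    show "(f \<circ> H) (u, s) = y0" if "0 \<le> u" "u \<le> 1" "s \<in> cube_boundary n" for u s
      using H(4)[OF that] f_base by simp
  qed blast
  have 1: "spheroid_homotopic n L base p (\<lambda>s. (x0, looping n b s))"
  proof (rule spheroid_homotopicI)
    show "continuous_map (prod_topology unit_interval (cube n)) L (\<lambda>d. (H d, M d))"
      by (rule continuous_map_into_L[OF H(1) M(1)]) (auto simp: M(4))
  qed (simp_all add: H(2,4) H1 M p_eq)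
  have \<beta>b: "spheroid_homotopic n LY (const_loop y0) \<beta> (looping n b)"
    by (rule spheroid_homotopicI[OF M(1,2,3,5)])
  have "spheroid_homotopic (Suc n) Y y0 (unloop n \<beta>) b"
    by (rule homotopic_with_trans[OF unloop_homotopic[OF n \<beta>b] unloop_looping[OF n b]])
  then have b_triv: "spheroid_homotopic (Suc n) Y y0 b (const_spheroid (Suc n) y0)"
    by (rule homotopic_with_trans[OF homotopic_with_symD \<beta>_triv])
  obtain N where N: "continuous_map (prod_topology unit_interval (cube n)) LY N"
    "\<And>s. s \<in> ?I \<Longrightarrow> N (0, s) = looping n b s"
    "\<And>s. s \<in> ?I \<Longrightarrow> N (1, s) = looping n (const_spheroid (Suc n) y0) s"
    "\<And>u s. 0 \<le> u \<Longrightarrow> u \<le> 1 \<Longrightarrow> s \<in> cube_boundary n \<Longrightarrow> N (u, s) = const_loop y0"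
    "\<And>u s. 0 \<le> u \<Longrightarrow> u \<le> 1 \<Longrightarrow> s \<in> ?I \<Longrightarrow> N (u, s) 1 = y0"
    using looping_homotopy[OF n1 y0 b_triv] by blast
  have const: "looping n (const_spheroid (Suc n) y0) s = const_loop y0" if "s \<in> ?I" for s
  proof -
    have "s(n := circle_arg w) \<in> topspace (cube (Suc n))" for w
      using circle_arg_mem[of w] by (intro cube_extend that) auto
    then show ?thesis using that by (simp add: looping_def const_spheroid_def const_loop_def)
  qed
  have 2: "spheroid_homotopic n L base (\<lambda>s. (x0, looping n b s)) (const_spheroid n base)"
  proof (rule spheroid_homotopicI)
    show "continuous_map (prod_topology unit_interval (cube n)) L (\<lambda>d. (x0, N d))"
      by (rule continuous_map_into_L[OF _ N(1)]) (auto simp: N(5) f_base x0)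
  qed (simp_all add: N const const_spheroid_eq)
  show ?thesis
    unfolding A one_homotopy_group
    by (rule spheroid_class_mono[OF homotopic_with_trans[OF 1 2]])
qed

section \<open>The splitting of the evaluation subgroups\<close>

text \<open>
  Precomposition with \<open>const_loop : X \<rightarrow> \<Lambda>X\<close> turns a spheroid of maps \<open>\<Lambda>X \<rightarrow> L\<close> into one of maps
  \<open>X \<rightarrow> L\<close>, which is a continuous map on \<open>I\<^sup>n \<times> X\<close>.  Both components of the splitting are then applied
  with \<open>x\<close> as a parameter.  On the boundary they yield \<open>x\<close> and \<open>f x\<close>, because \<open>\<phi>\<close> takes the constant
  loop at \<open>x\<close> to \<open>x\<close> and the constant loop at \<open>f x\<close>.
\<close>

lemma splitting_evaluation_subgroup:
  assumes n: "n \<ge> 2" and nb: "neighbourhood_base_of (compactin X) X"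
    and A: "A \<in> carrier (evaluation_subgroup n L LX (whisker_map f) (const_loop x0))"
  shows "splitting n A \<in> carrier (gottlieb_group n X x0 \<times>\<times> evaluation_subgroup (Suc n) Y X f x0)"
proof -
  have n1: "n \<ge> 1" using n by simp
  obtain P where P: "continuous_map (cube n) (compact_open_topology LX L) P"
    and Pbd: "\<And>s. s \<in> cube_boundary n \<Longrightarrow> P s = restrict (whisker_map f) (topspace LX)"
    and p: "(\<lambda>s\<in>topspace (cube n). P s (const_loop x0)) \<in> spheroids n L base"
    and A: "A = spheroid_class n L base (\<lambda>s\<in>topspace (cube n). P s (const_loop x0))"
    using evaluation_subgroupE[OF A const_loop_LX[OF x0]] unfolding whisker_map_base by blast
  define F where "F s x = P s (const_loop x)" for s x
  have "continuous_map (cube n) (compact_open_topology X L)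
      (\<lambda>s. restrict (P s \<circ> const_loop) (topspace X))"
    using continuous_map_compose[OF P continuous_map_compact_open_precompose[OF continuous_map_const_loop]]
    by (simp add: o_def)
  note uncurry = continuous_map_uncurry[OF nb this]
  have F: "continuous_map S L (\<lambda>d. F (\<sigma> d) (x d))"
    if "continuous_map S (cube n) \<sigma>" "continuous_map S X x" for S :: "'s topology" and \<sigma> x
    using uncurry[OF that]
  proof (rule continuous_map_eq)
    fix d assume "d \<in> topspace S"
    then have "x d \<in> topspace X" using continuous_map_image_subset_topspace[OF that(2)] by blast
    then show "restrict (P (\<sigma> d) \<circ> const_loop) (topspace X) (x d) = F (\<sigma> d) (x d)"
      by (simp add: F_def)
  qed
  have Fbd: "F s x = (x, const_loop (f x))" if "s \<in> cube_boundary n" "x \<in> topspace X" for s x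
    using Pbd[OF that(1)] const_loop_LX[OF that(2)] by (simp add: F_def whisker_map_const_loop)
  have "spheroid_class n X x0 (\<lambda>s\<in>topspace (cube n). fst (F s x0)) \<in> carrier (gottlieb_group n X x0)"
  proof -
    have "continuous_map (prod_topology (cube n) X) X (\<lambda>d. fst (F (fst d) (snd d)))"
      using continuous_map_compose[OF F[OF continuous_map_fst continuous_map_snd] continuous_map_fst_L]
      by (simp add: o_def)
    from evaluation_subgroupI[OF n1 this, of "\<lambda>v. v" x0] show ?thesis
      by (simp add: gottlieb_group_def Fbd x0)
  qed
  moreover have "spheroid_class (Suc n) Y y0 (\<lambda>s\<in>topspace (cube (Suc n)). unloop n (\<lambda>s. snd (F s x0)) s)
      \<in> carrier (evaluation_subgroup (Suc n) Y X f x0)"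
  proof -
    have "continuous_map (prod_topology X (cube n)) (compact_open_topology circle Y)
        (\<lambda>d. snd (F (snd d) (fst d)))"
      using continuous_map_free_loop_space_full[OF
          continuous_map_compose[OF F[OF continuous_map_snd continuous_map_fst] continuous_map_snd_L]]
      by (simp add: o_def)
    from continuous_map_unloop[OF n this, of f, OF _ continuous_map_snd continuous_map_fst]
    have "continuous_map (prod_topology (cube (Suc n)) X) Y
        (\<lambda>d. unloop n (\<lambda>s. snd (F s (snd d))) (fst d))"
      by (simp add: Fbd)
    from evaluation_subgroupI[OF _ this, of f x0] show ?thesis
      using f_base x0 by (simp add: unloop_boundary[OF n] Fbd)
  qed
  moreover have "restrict (fst \<circ> (\<lambda>s\<in>topspace (cube n). P s (const_loop x0))) (topspace (cube n))
      = (\<lambda>s\<in>topspace (cube n). fst (F s x0))"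
    by (auto simp: F_def)
  moreover have "unloop n (restrict (snd \<circ> (\<lambda>s\<in>topspace (cube n). P s (const_loop x0))) (topspace (cube n)))
      = (\<lambda>s\<in>topspace (cube (Suc n)). unloop n (\<lambda>s. snd (F s x0)) s)"
    by (auto simp: F_def unloop_def squeeze_mem n)
  ultimately show ?thesis
    unfolding A splitting_class[OF n p] by (simp add: DirProd_def)
qed

text \<open>
  A family of self-maps of \<open>X\<close> acts pointwise on the loops of \<open>X\<close>.  On the constant loop at \<open>x0\<close> it
  yields constant loops only, which the second component of the splitting kills.
\<close>

lemma gottlieb_in_splitting_image:
  assumes n: "n \<ge> 2" and nb: "neighbourhood_base_of (compactin X) X"
    and g: "g \<in> carrier (gottlieb_group n X x0)"
  shows "\<exists>A \<in> carrier (evaluation_subgroup n L LX (whisker_map f) (const_loop x0)).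
           splitting n A = (g, \<one>\<^bsub>homotopy_group (Suc n) Y y0\<^esub>)"
proof -
  have n1: "n \<ge> 1" using n by simp
  obtain P where P: "continuous_map (cube n) (compact_open_topology X X) P"
    and Pbd: "\<And>s. s \<in> cube_boundary n \<Longrightarrow> P s = restrict (\<lambda>v. v) (topspace X)"
    and a: "(\<lambda>s\<in>topspace (cube n). P s x0) \<in> spheroids n X x0"
    and g: "g = spheroid_class n X x0 (\<lambda>s\<in>topspace (cube n). P s x0)"
    using evaluation_subgroupE[OF g[unfolded gottlieb_group_def] x0] by blast
  note uncurry = continuous_map_uncurry[OF nb P]
  define M where "M d = (\<lambda>w\<in>topspace circle. f (P (snd d) (fst d w)))" for d :: "(complex \<Rightarrow> 'a) \<times> (nat \<Rightarrow> real)"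
  have mem: "\<alpha> w \<in> topspace X" if "\<alpha> \<in> topspace LX" "w \<in> sphere 0 1" for \<alpha> w
    using continuous_map_image_subset_topspace[OF continuous_map_loop_eval[of LX "\<lambda>\<alpha>. \<alpha>" "\<lambda>_. w"]] that
    by auto
  have Mbd: "M (\<alpha>, s) = restrict (f \<circ> \<alpha>) (topspace circle)" if "\<alpha> \<in> topspace LX" "s \<in> cube_boundary n" for \<alpha> s
    using mem[OF that(1)] Pbd[OF that(2)] by (auto simp: M_def)
  have M: "continuous_map (prod_topology LX (cube n)) LY M"
  proof (rule continuous_map_into_free_loop_space[OF n1])
    let ?E = "prod_topology (prod_topology LX (cube n)) circle"
    have c: "continuous_map ?E (cube n) (\<lambda>e. snd (fst e))" "continuous_map ?E LX (\<lambda>e. fst (fst e))"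
      using continuous_map_compose[OF continuous_map_fst continuous_map_snd, of LX "cube n" circle]
        continuous_map_compose[OF continuous_map_fst continuous_map_fst, of LX "cube n" circle]
      by (auto simp: o_def)
    have "continuous_map ?E Y (\<lambda>e. f (P (snd (fst e)) (fst (fst e) (snd e))))"
      using continuous_map_compose[OF uncurry[OF c(1) continuous_map_loop_eval[OF c(2) continuous_map_snd]] f]
      by (simp add: o_def)
    from continuous_map_curry[OF this]
    show "continuous_map (prod_topology LX (cube n)) (compact_open_topology circle Y) M"
      by (simp add: M_def[abs_def])
    show "M (\<alpha>, s) \<in> path_component_of_set (compact_open_topology circle Y) (const_loop y0)"
      if "\<alpha> \<in> topspace LX" "s \<in> cube_boundary n" for \<alpha> s
      unfolding Mbd[OF that] by (rule compose_loop_component[OF that(1)])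
  qed
  define F where "F d = (P (fst d) (snd d 1), M (snd d, fst d))" for d
  have F: "continuous_map (prod_topology (cube n) LX) L F"
    unfolding F_def[abs_def]
  proof (rule continuous_map_into_L)
    show "continuous_map (prod_topology (cube n) LX) X (\<lambda>d. P (fst d) (snd d 1))"
      by (intro uncurry continuous_map_fst continuous_map_loop_eval continuous_map_snd) simp
    show "continuous_map (prod_topology (cube n) LX) LY (\<lambda>d. M (snd d, fst d))"
      using continuous_map_compose[OF continuous_map_pairedI[OF continuous_map_snd continuous_map_fst] M]
      by (simp add: o_def)
  qed (simp add: M_def)
  have Fbd: "F (s, \<alpha>) = whisker_map f \<alpha>" if "s \<in> cube_boundary n" "\<alpha> \<in> topspace LX" for s \<alpha>
    using Mbd[OF that(2,1)] Pbd[OF that(1)] mem[OF that(2), of 1] by (simp add: F_def whisker_map_def)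
  have F0: "F (s, const_loop x0) = (P s x0, const_loop (f (P s x0)))" for s
    by (auto simp: F_def M_def const_loop_def)
  let ?A = "\<lambda>s\<in>topspace (cube n). F (s, const_loop x0)"
  have p: "?A \<in> spheroids n L base"
    by (rule evaluation_spheroid[OF F _ const_loop_LX[OF x0]])
      (simp add: Fbd const_loop_LX[OF x0] whisker_map_base)
  have "spheroid_class n L base ?A \<in> carrier (evaluation_subgroup n L LX (whisker_map f) (const_loop x0))"
    using evaluation_subgroupI[OF n1 F Fbd const_loop_LX[OF x0]] unfolding whisker_map_base by simp
  moreover have "splitting n (spheroid_class n L base ?A) = (g, \<one>\<^bsub>homotopy_group (Suc n) Y y0\<^esub>)"
  proof -
    let ?fa = "restrict (f \<circ> (\<lambda>s\<in>topspace (cube n). P s x0)) (topspace (cube n))"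
    have fa: "?fa \<in> spheroids n Y y0" by (rule compose_spheroids[OF f f_base a])
    have "restrict (fst \<circ> ?A) (topspace (cube n)) = (\<lambda>s\<in>topspace (cube n). P s x0)"
      by (auto simp: F0)
    moreover have "restrict (snd \<circ> ?A) (topspace (cube n)) = (\<lambda>s\<in>topspace (cube n). const_loop (?fa s))"
      by (auto simp: F0)
    ultimately show ?thesis
      using spheroid_class_mono[OF unloop_const_loops[OF n fa]]
      by (simp add: splitting_class[OF n p] g one_homotopy_group)
  qed
  ultimately show ?thesis by blast
qed

text \<open>
  A family of maps \<open>X \<rightarrow> Y\<close> over \<open>I\<^sup>n\<^sup>+\<^sup>1\<close> acts on a loop of \<open>X\<close> when the last coordinate is read as the
  loop parameter.  At its ends the family is \<open>f\<close>, so the result is a loop at the image of the base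
  point; on the constant loop at \<open>x0\<close> it is the curried form of the given spheroid.
\<close>

lemma evaluation_in_splitting_image:
  assumes n: "n \<ge> 2" and nb: "neighbourhood_base_of (compactin X) X"
    and h: "h \<in> carrier (evaluation_subgroup (Suc n) Y X f x0)"
  shows "\<exists>A \<in> carrier (evaluation_subgroup n L LX (whisker_map f) (const_loop x0)).
           splitting n A = (\<one>\<^bsub>homotopy_group n X x0\<^esub>, h)"
proof -
  have n1: "n \<ge> 1" using n by simp
  obtain Q where Q: "continuous_map (cube (Suc n)) (compact_open_topology X Y) Q"
    and Qbd: "\<And>s. s \<in> cube_boundary (Suc n) \<Longrightarrow> Q s = restrict f (topspace X)"
    and b: "(\<lambda>s\<in>topspace (cube (Suc n)). Q s x0) \<in> spheroids (Suc n) Y y0"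
    and h: "h = spheroid_class (Suc n) Y y0 (\<lambda>s\<in>topspace (cube (Suc n)). Q s x0)"
    using evaluation_subgroupE[OF h x0] f_base by blast
  note uncurry = continuous_map_uncurry[OF nb Q]
  define G where "G e = Q ((snd (fst e))(n := snd e)) (fst (fst e) (circle_exp (snd e)))"
    for e :: "((complex \<Rightarrow> 'a) \<times> (nat \<Rightarrow> real)) \<times> real"
  define M where "M d = (\<lambda>w\<in>topspace circle. G (d, circle_arg w))" for d
  have mem: "\<alpha> w \<in> topspace X" if "\<alpha> \<in> topspace LX" "w \<in> sphere 0 1" for \<alpha> w
    using continuous_map_image_subset_topspace[OF continuous_map_loop_eval[of LX "\<lambda>\<alpha>. \<alpha>" "\<lambda>_. w"]] that
    by auto
  have Gend: "G ((\<alpha>, s), t) = f (\<alpha> 1)" if "\<alpha> \<in> topspace LX" "s \<in> topspace (cube n)" "t = 0 \<or> t = 1" for \<alpha> s t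
    using that Qbd[OF cube_extend_ends[OF that(2,3)]] mem[OF that(1), of 1] by (auto simp: G_def)
  have Mbd: "M (\<alpha>, s) = restrict (f \<circ> \<alpha>) (topspace circle)" if "\<alpha> \<in> topspace LX" "s \<in> cube_boundary n" for \<alpha> s
  proof
    fix w
    have "Q (s(n := circle_arg w)) = restrict f (topspace X)"
      using circle_arg_mem[of w] by (intro Qbd cube_extend_boundary that) auto
    then show "M (\<alpha>, s) w = restrict (f \<circ> \<alpha>) (topspace circle) w"
      using mem[OF that(1)] by (simp add: M_def G_def circle_exp_arg)
  qed
  have M: "continuous_map (prod_topology LX (cube n)) LY M"
  proof (rule continuous_map_into_free_loop_space[OF n1])
    let ?E = "prod_topology (prod_topology LX (cube n)) unit_interval"
    have c: "continuous_map ?E (cube n) (\<lambda>e. snd (fst e))" "continuous_map ?E LX (\<lambda>e. fst (fst e))"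
      "continuous_map ?E circle (\<lambda>e. circle_exp (snd e))"
      using continuous_map_compose[OF continuous_map_fst continuous_map_snd, of LX "cube n" unit_interval]
        continuous_map_compose[OF continuous_map_fst continuous_map_fst, of LX "cube n" unit_interval]
        continuous_map_compose[OF continuous_map_snd continuous_map_circle_exp,
          of "prod_topology LX (cube n)"]
      by (auto simp: o_def)
    have s: "continuous_map ?E (cube (Suc n)) (\<lambda>e. (snd (fst e))(n := snd e))"
      by (intro continuous_map_cube_extend c continuous_map_unit_interval_real continuous_map_snd) auto
    have "continuous_map ?E Y G"
      unfolding G_def[abs_def] by (rule uncurry[OF s continuous_map_loop_eval[OF c(2,3)]])
    then show "continuous_map (prod_topology LX (cube n)) (compact_open_topology circle Y) M"
      unfolding M_def[abs_def]
      by (rule continuous_map_into_loops) (auto simp: Gend)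
    show "M (\<alpha>, s) \<in> path_component_of_set (compact_open_topology circle Y) (const_loop y0)"
      if "\<alpha> \<in> topspace LX" "s \<in> cube_boundary n" for \<alpha> s
      unfolding Mbd[OF that] by (rule compose_loop_component[OF that(1)])
  qed
  define F where "F d = (snd d 1, M (snd d, fst d))" for d
  have F: "continuous_map (prod_topology (cube n) LX) L F"
    unfolding F_def[abs_def]
  proof (rule continuous_map_into_L)
    show "continuous_map (prod_topology (cube n) LX) X (\<lambda>d. snd d 1)"
      by (intro continuous_map_loop_eval continuous_map_snd) simp
    show "continuous_map (prod_topology (cube n) LX) LY (\<lambda>d. M (snd d, fst d))"
      using continuous_map_compose[OF continuous_map_pairedI[OF continuous_map_snd continuous_map_fst] M]
      by (simp add: o_def)
  qed (auto simp: M_def Gend)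
  have Fbd: "F (s, \<alpha>) = whisker_map f \<alpha>" if "s \<in> cube_boundary n" "\<alpha> \<in> topspace LX" for s \<alpha>
    using Mbd[OF that(2,1)] by (simp add: F_def whisker_map_def)
  let ?A = "\<lambda>s\<in>topspace (cube n). F (s, const_loop x0)"
  let ?b = "\<lambda>s\<in>topspace (cube (Suc n)). Q s x0"
  have p: "?A \<in> spheroids n L base"
    by (rule evaluation_spheroid[OF F _ const_loop_LX[OF x0]])
      (simp add: Fbd const_loop_LX[OF x0] whisker_map_base)
  have "spheroid_class n L base ?A \<in> carrier (evaluation_subgroup n L LX (whisker_map f) (const_loop x0))"
    using evaluation_subgroupI[OF n1 F Fbd const_loop_LX[OF x0]] unfolding whisker_map_base by simp
  moreover have "splitting n (spheroid_class n L base ?A) = (\<one>\<^bsub>homotopy_group n X x0\<^esub>, h)"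
  proof -
    have "restrict (fst \<circ> ?A) (topspace (cube n)) = const_spheroid n x0"
      by (auto simp: F_def const_spheroid_def const_loop_eq)
    moreover have "restrict (snd \<circ> ?A) (topspace (cube n)) = looping n ?b"
    proof
      fix s
      have "s(n := circle_arg w) \<in> topspace (cube (Suc n))" if "s \<in> topspace (cube n)" for w
        using circle_arg_mem[of w] by (intro cube_extend that) auto
      then show "restrict (snd \<circ> ?A) (topspace (cube n)) s = looping n ?b s"
        using circle_exp_mem by (auto simp: F_def M_def G_def looping_def const_loop_eq)
    qed
    ultimately show ?thesis
      using spheroid_class_mono[OF unloop_looping[OF n b]]
      by (simp add: splitting_class[OF n p] h one_homotopy_group)
  qed
  ultimately show ?thesis by blast
qed

lemma splitting_iso:
  assumes n: "n \<ge> 2" and nb: "neighbourhood_base_of (compactin X) X"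
  shows "splitting n \<in> iso (evaluation_subgroup n L LX (whisker_map f) (const_loop x0))
           (gottlieb_group n X x0 \<times>\<times> evaluation_subgroup (Suc n) Y X f x0)"
proof -
  let ?P = "homotopy_group n L base" and ?Q = "homotopy_group n X x0" and ?R = "homotopy_group (Suc n) Y y0"
  let ?E = "evaluation_subgroup n L LX (whisker_map f) (const_loop x0)"
  let ?F = "gottlieb_group n X x0 \<times>\<times> evaluation_subgroup (Suc n) Y X f x0"
  have n1: "n \<ge> 1" using n by simp
  interpret P: group ?P by (rule group_homotopy_group[OF n1 base_mem])
  interpret Q: group ?Q by (rule group_homotopy_group[OF n1 x0])
  interpret R: group ?R by (rule group_homotopy_group[OF _ y0]) simp
  have hom: "splitting n \<in> hom ?P (?Q \<times>\<times> ?R)" by (rule splitting_hom[OF n])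
  have inj: "inj_on (splitting n) (carrier ?P)"
    using inj_on_one_iff'[OF hom P.group_axioms DirProd_group[OF Q.group_axioms R.group_axioms]]
      splitting_kernel[OF n] by blast
  have E: "subgroup (carrier ?E) ?P"
    using subgroup_evaluation_subgroup[OF n1 continuous_map_whisker const_loop_LX[OF x0]]
    unfolding whisker_map_base .
  have multE: "mult ?E = mult ?P" by (simp add: evaluation_subgroup_def whisker_map_base)
  have multF: "mult ?F = mult (?Q \<times>\<times> ?R)"
    by (simp add: DirProd_def gottlieb_group_def evaluation_subgroup_def f_base)
  have "subgroup (carrier (gottlieb_group n X x0)) ?Q"
    using subgroup_evaluation_subgroup[OF n1, of X X "\<lambda>v. v" x0] x0 by (simp add: gottlieb_group_def)
  moreover have "subgroup (carrier (evaluation_subgroup (Suc n) Y X f x0)) ?R"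
    using subgroup_evaluation_subgroup[OF _ f x0, of "Suc n"] f_base by simp
  ultimately have sub: "carrier (gottlieb_group n X x0) \<subseteq> carrier ?Q"
      "carrier (evaluation_subgroup (Suc n) Y X f x0) \<subseteq> carrier ?R"
    by (auto dest: subgroup.subset)
  have "splitting n ` carrier ?E = carrier ?F"
  proof (intro equalityI subsetI)
    show "z \<in> carrier ?F" if "z \<in> splitting n ` carrier ?E" for z
      using that splitting_evaluation_subgroup[OF n nb] by auto
    fix z assume "z \<in> carrier ?F"
    then obtain g h where z: "z = (g, h)" and g: "g \<in> carrier (gottlieb_group n X x0)"
      and h: "h \<in> carrier (evaluation_subgroup (Suc n) Y X f x0)"
      by (auto simp: DirProd_def)
    obtain A where A: "A \<in> carrier ?E" "splitting n A = (g, \<one>\<^bsub>?R\<^esub>)"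
      using gottlieb_in_splitting_image[OF n nb g] by blast
    obtain B where B: "B \<in> carrier ?E" "splitting n B = (\<one>\<^bsub>?Q\<^esub>, h)"
      using evaluation_in_splitting_image[OF n nb h] by blast
    have "splitting n (A \<otimes>\<^bsub>?P\<^esub> B) = splitting n A \<otimes>\<^bsub>?Q \<times>\<times> ?R\<^esub> splitting n B"
      using A(1) B(1) subgroup.mem_carrier[OF E] by (intro hom_mult[OF hom])
    also have "\<dots> = (g, h)"
      using A(2) B(2) g h sub by auto
    finally show "z \<in> splitting n ` carrier ?E"
      using subgroup.m_closed[OF E A(1) B(1)] z by (metis image_eqI)
  qed
  moreover have "inj_on (splitting n) (carrier ?E)"
    using inj subgroup.subset[OF E] by (rule inj_on_subset)
  moreover have "splitting n (x \<otimes>\<^bsub>?E\<^esub> y) = splitting n x \<otimes>\<^bsub>?F\<^esub> splitting n y"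
    if "x \<in> carrier ?E" "y \<in> carrier ?E" for x y
    unfolding multE multF using that subgroup.mem_carrier[OF E] by (intro hom_mult[OF hom])
  ultimately show ?thesis
    by (auto simp: iso_def hom_def bij_betw_def)
qed

end

theorem theorem4:
  fixes X :: "'a topology" and Y :: "'b topology"
    and x0 :: 'a and y0 :: 'b and f :: "'a \<Rightarrow> 'b" and n :: nat
  assumes "path_connected_space X" "locally_compact_space X" "Hausdorff_space X"
      "well_pointed X x0"
    and "path_connected_space Y" "locally_compact_space Y" "Hausdorff_space Y"
      "well_pointed Y y0"
    and "continuous_map X Y f" "f x0 = y0"
    and "n \<ge> 2"
  shows "comm_group (evaluation_subgroup n (relative_free_loop_space X Y f y0)
             (free_loop_space X x0) (whisker_map f) (const_loop x0)) \<and>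
         comm_group (gottlieb_group n X x0) \<and>
         comm_group (evaluation_subgroup (n + 1) Y X f x0) \<and>
         evaluation_subgroup n (relative_free_loop_space X Y f y0)
             (free_loop_space X x0) (whisker_map f) (const_loop x0)
           \<cong> gottlieb_group n X x0 \<times>\<times> evaluation_subgroup (n + 1) Y X f x0"
proof (intro conjI)
  have x0: "x0 \<in> topspace X" using assms(4) by (simp add: well_pointed_def)
  interpret relative_loops X Y f x0 y0
    by unfold_locales (use assms x0 in auto)
  have nb: "neighbourhood_base_of (compactin X) X"
    by (rule compact_neighbourhoods_if_locally_compact_Hausdorff) fact+
  show "comm_group (evaluation_subgroup n L LX (whisker_map f) (const_loop x0))"
    by (rule comm_group_evaluation_subgroup[OF assms(11) continuous_map_whisker const_loop_LX[OF x0]])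
  show "comm_group (gottlieb_group n X x0)"
    unfolding gottlieb_group_def
    by (rule comm_group_evaluation_subgroup[OF assms(11) _ x0]) simp
  show "comm_group (evaluation_subgroup (n + 1) Y X f x0)"
    by (rule comm_group_evaluation_subgroup[OF _ f x0]) (use assms(11) in simp)
  show "evaluation_subgroup n L LX (whisker_map f) (const_loop x0)
      \<cong> gottlieb_group n X x0 \<times>\<times> evaluation_subgroup (n + 1) Y X f x0"
    using splitting_iso[OF assms(11) nb] by (auto simp: is_iso_def)
qed

end
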